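(* Let $T \in \mathbb{N} \cup \{+\infty\}$, $\mathbb{N}_{\le T} = \{0,\dots,T\}$ (or $\mathbb{N}$ if $T=+\infty$), and $\mathbb{N}_{\le T-1}$ defined analogously. Consider random regressors $M_t \in \mathbb{R}^{m\times n}$, outputs $y_{t+1}\in\mathbb{R}^m$ and noise $w_t \in \mathbb{R}^m$ with $y_{t+1} = M_t\theta^\star + w_t$ for $t \in \mathbb{N}_{\le T-1}$, where $\theta^\star\in\mathbb{R}^n$ is deterministic and unknown. Let $\mathcal{D}_t = \{M_0,y_1,M_1,\dots,y_t,M_t\}$, $W\succ 0$ a symmetric positive definite $m\times m$ matrix, $\mu\in\mathbb{R}^n$, and $P\in\mathbb{R}^{n\times n}$ symmetric positive semidefinite. Let $V_t = \sum_{k=0}^{t-1} M_k^\top W M_k$ and, whenever $P+V_t\succ 0$, let $\hat\theta_t$ be the unique minimizer of $\|\theta-\mu\|_P^2 + \sum_{k=0}^{t-1}\|y_{k+1}-M_k\theta\|_W^2$. Assume (i) for a known $c_w>0$ and all $t\in\mathbb{N}_{\le T-1}$, $\mathbb{E}[e^{\nu^\top w_t}\mid\mathcal{D}_t] \le e^{\frac12 c_w^2\nu^\top W^{-1}\nu}$ for all $\nu\in\mathbb{R}^m$; and (ii) for a known $c_\theta\ge0$, $\|\theta^\star-\mu\|_P\le c_\theta$. Let $\bar V\in\mathbb{R}^{n\times n}$ be any symmetric positive definite matrix, $\delta\in(0,1)$, and define $$\beta_t = \sqrt{1+\rho(V_t^{-1}\bar V)}\,\sqrt{c_\theta^2 +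 c_w^2\log\left|I_n+\bar V^{-1}V_t\right| + 2c_w^2\log(1/\delta)}$$ when $V_t$ is invertible, and $\beta_t=+\infty$ when $V_t$ is not invertible. Then $$\mathbb{P}\left[\|\theta^\star-\hat\theta_t\|_{P+V_t}\le\beta_t,\ \forall t\in\mathbb{N}_{\le T}\right]\ge 1-\delta,$$ where the inequality is regarded as trivially satisfied at times with $\beta_t=+\infty$.
   Context: For a symmetric positive definite $A$, $\|x\|_A^2 = x^\top A x$ (for $A\succeq0$, $\|x\|_A = \sqrt{x^\top A x}$); $|A|$ denotes the determinant and $\rho(A)$ the spectral radius of a square matrix $A$. The probability is over the data-generation process; $\theta^\star$ is deterministic. *)

theory Defs
  imports "HOL-Analysis.Analysis" "HOL-Probability.Probability"
begin

definition sym_mat :: "real^'n^'n \<Rightarrow> bool" where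
  "sym_mat A \<longleftrightarrow> transpose A = A"

definition pos_def :: "real^'n^'n \<Rightarrow> bool" where
  "pos_def A \<longleftrightarrow> sym_mat A \<and> (\<forall>x. x \<noteq> 0 \<longrightarrow> x \<bullet> (A *v x) > 0)"

definition pos_semidef :: "real^'n^'n \<Rightarrow> bool" where
  "pos_semidef A \<longleftrightarrow> sym_mat A \<and> (\<forall>x. x \<bullet> (A *v x) \<ge> 0)"

definition wnorm :: "real^'n^'n \<Rightarrow> real^'n \<Rightarrow> real" where
  "wnorm A x = sqrt (x \<bullet> (A *v x))"

definition spec_radius :: "real^'n^'n \<Rightarrow> real" where
  "spec_radius A = Max {cmod l | l. \<exists>v::complex^'n. v \<noteq> 0 \<and>
       (\<chi> i j. complex_of_real (A $ i $ j)) *v v = l *s v}"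

definition Vmat :: "(nat \<Rightarrow> 'a \<Rightarrow> real^'n^'m) \<Rightarrow> real^'m^'m \<Rightarrow> nat \<Rightarrow> 'a \<Rightarrow> real^'n^'n" where
  "Vmat Mr W t \<omega> = (\<Sum>k<t. transpose (Mr k \<omega>) ** W ** Mr k \<omega>)"

text \<open>Regularized least-squares cost and its (unique, when P+V_t is PD) minimizer.\<close>
definition ls_cost :: "(nat \<Rightarrow> 'a \<Rightarrow> real^'n^'m) \<Rightarrow> (nat \<Rightarrow> 'a \<Rightarrow> real^'m) \<Rightarrow> real^'m^'m
    \<Rightarrow> real^'n^'n \<Rightarrow> real^'n \<Rightarrow> nat \<Rightarrow> 'a \<Rightarrow> real^'n \<Rightarrow> real" where
  "ls_cost Mr y W P \<mu> t \<omega> \<theta> =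
     (wnorm P (\<theta> - \<mu>))\<^sup>2 + (\<Sum>k<t. (wnorm W (y (Suc k) \<omega> - Mr k \<omega> *v \<theta>))\<^sup>2)"

definition theta_hat :: "(nat \<Rightarrow> 'a \<Rightarrow> real^'n^'m) \<Rightarrow> (nat \<Rightarrow> 'a \<Rightarrow> real^'m) \<Rightarrow> real^'m^'m
    \<Rightarrow> real^'n^'n \<Rightarrow> real^'n \<Rightarrow> nat \<Rightarrow> 'a \<Rightarrow> real^'n" where
  "theta_hat Mr y W P \<mu> t \<omega> =
     (THE \<theta>. \<forall>\<theta>'. ls_cost Mr y W P \<mu> t \<omega> \<theta> \<le> ls_cost Mr y W P \<mu> t \<omega> \<theta>')"

definition info_alg :: "'a measure \<Rightarrow> (nat \<Rightarrow> 'a \<Rightarrow> real^'n^'m) \<Rightarrow> (nat \<Rightarrow> 'a \<Rightarrow> real^'m)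
    \<Rightarrow> nat \<Rightarrow> 'a measure" where
  "info_alg M Mr y t = sigma (space M)
     ((\<Union>k\<in>{..t}. {Mr k -` A \<inter> space M | A. A \<in> sets borel}) \<union>
      (\<Union>k\<in>{..<t}. {y (Suc k) -` A \<inter> space M | A. A \<in> sets borel}))"

text \<open>Confidence radius beta_t (only used when V_t is invertible; otherwise beta_t = +infinity).\<close>
definition beta :: "real \<Rightarrow> real \<Rightarrow> real \<Rightarrow> real^'n^'n \<Rightarrow> real^'n^'n \<Rightarrow> real" where
  "beta c\<theta> cw \<delta> Vbar V =
     sqrt (1 + spec_radius (matrix_inv V ** Vbar)) *
     sqrt (c\<theta>\<^sup>2 + cw\<^sup>2 * ln (det (mat 1 + matrix_inv Vbar ** V)) + 2 * cw\<^sup>2 * ln (1 / \<delta>))"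

end

theory Submission
  imports Defs
begin

text \<open>
  Let \<open>S\<^sub>t = \<Sum>k<t. M\<^sub>k\<^sup>T W w\<^sub>k\<close>. For every fixed \<open>l\<close>, the process
  \<open>exp (l \<bullet> S\<^sub>t / c - l \<bullet> V\<^sub>t l / 2)\<close> is a nonnegative supermartingale. Averaging it over a Gaussian \<open>l\<close>
  with covariance equal to the inverse of \<open>Vbar\<close> gives, up to a constant, the supermartingale
  \<open>exp (z \<bullet> S\<^sub>t / (2 c\<^sup>2)) / sqrt (det (V\<^sub>t + Vbar))\<close> with \<open>(V\<^sub>t + Vbar) z = S\<^sub>t\<close>. Ville's inequality bounds
  \<open>z \<bullet> S\<^sub>t\<close> for all \<open>t\<close> simultaneously. The error of the estimator solves
  \<open>(P + V\<^sub>t) (\<theta>\<^sup>* - \<theta>\<^sub>t) = P (\<theta>\<^sup>* - \<mu>) - S\<^sub>t\<close>; completing squares separates the prior from the noise, and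
  \<open>V\<^sub>t + Vbar \<le> (1 + \<rho>) V\<^sub>t\<close> turns the bound on \<open>z \<bullet> S\<^sub>t\<close> into the claimed one.
\<close>

text \<open>The noise assumption is available for each deterministic \<open>\<nu>\<close>, off a
  null set that depends on \<open>\<nu>\<close>, while the supermartingale property is needed in a
  random direction determined by \<open>M\<^sub>t\<close>. Approximation by simple functions and
  Fatou's lemma bridge this gap.

  The matrix \<open>P\<close> may be singular, even zero, so it cannot be the precision of the
  mixing Gaussian; \<open>Vbar\<close> takes that role. The estimation error is then measured with
  \<open>P + V\<^sub>t\<close> but the noise with \<open>V\<^sub>t + Vbar\<close>, and the factor 1
  + \<rho> is the price of comparing the two when \<open>V\<^sub>t\<close> is invertible.

  All expectations are integrals of nonnegative extended functions, so exchanging integrals and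
  conditioning raise no question of integrability. A separate obstacle is the measurability of the
  final event: \<open>theta_hat\<close> is a definite description and \<open>spec_radius\<close> a
  maximum over complex eigenvalues. Cramer's rule and the Rayleigh quotient give descriptions that
  are visibly measurable.\<close>

subsection \<open>Spectral theorem for symmetric matrices\<close>

text \<open>A maximizer of the Rayleigh quotient on the unit sphere of \<open>U\<close> is an
  eigenvector: the residual \<open>h\<close> stays in \<open>U\<close> by invariance, and a small
  move along a nonzero \<open>h\<close> would increase the quotient at first order.\<close>

lemma self_adjoint_max_eigenvector:
  fixes f :: "'a::euclidean_space \<Rightarrow> 'a"
  assumes f: "linear f" and sa: "\<And>x y. f x \<bullet> y = x \<bullet> f y"
    and U: "subspace U" and inv: "\<And>x. x \<in> U \<Longrightarrow> f x \<in> U" and nz: "U \<noteq> {0}"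
  shows "\<exists>x\<in>U. norm x = 1 \<and> f x = (x \<bullet> f x) *\<^sub>R x"
proof -
  have "compact (U \<inter> sphere 0 1)"
    using U by (simp add: closed_subspace closed_Int_compact)
  moreover have "U \<inter> sphere 0 1 \<noteq> {}"
  proof -
    obtain u where u: "u \<in> U" "u \<noteq> 0" using nz U subspace_0 by blast
    hence "(1 / norm u) *\<^sub>R u \<in> U \<inter> sphere 0 1" using U by (simp add: subspace_scale)
    thus ?thesis by blast
  qed
  moreover have "continuous_on (U \<inter> sphere 0 1) (\<lambda>x. x \<bullet> f x)"
    using linear_continuous_on[of f] f by (intro continuous_intros) (simp add: linear_linear)
  ultimately obtain x where "x \<in> U \<inter> sphere 0 1" "\<forall>u\<in>U \<inter> sphere 0 1. u \<bullet> f u \<le> x \<bullet> f x"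
    using continuous_attains_sup[of "U \<inter> sphere 0 1" "\<lambda>x. x \<bullet> f x"] by blast
  hence x: "x \<in> U" "norm x = 1"
    and max: "\<And>u. u \<in> U \<Longrightarrow> norm u = 1 \<Longrightarrow> u \<bullet> f u \<le> x \<bullet> f x"
    by auto
  define l where "l = x \<bullet> f x"
  define g where "g u = u \<bullet> f u - l * (u \<bullet> u)" for u
  have xx: "x \<bullet> x = 1" using x by (simp add: dot_square_norm)
  have g_le: "g u \<le> 0" if "u \<in> U" for u
  proof (cases "u = 0")
    case False
    have "((1 / norm u) *\<^sub>R u) \<bullet> f ((1 / norm u) *\<^sub>R u) \<le> l"
      unfolding l_def using that False U by (intro max) (auto simp: subspace_scale)
    hence "(u \<bullet> f u) / (norm u)\<^sup>2 \<le> l"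
      using f by (simp add: linear_cmul power2_eq_square)
    thus ?thesis using False by (simp add: g_def field_simps dot_square_norm)
  qed (simp add: g_def linear_0[OF f])
  define h where "h = f x - l *\<^sub>R x"
  have hU: "h \<in> U" unfolding h_def using x inv U by (simp add: subspace_diff subspace_scale)
  have expand: "g (x + t *\<^sub>R h) = 2 * t * (h \<bullet> h) + t\<^sup>2 * g h" for t
  proof -
    have "x \<bullet> f h = h \<bullet> f x" by (metis sa inner_commute)
    hence "g (x + t *\<^sub>R h) = l + 2 * t * (h \<bullet> f x) + t\<^sup>2 * (h \<bullet> f h)
        - l * (1 + 2 * t * (h \<bullet> x) + t\<^sup>2 * (h \<bullet> h))"
      using f xx unfolding g_def l_def
      by (simp add: linear_add linear_cmul inner_add inner_commute power2_eq_square algebra_simps)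
    also have "\<dots> = 2 * t * (h \<bullet> (f x - l *\<^sub>R x)) + t\<^sup>2 * g h"
      unfolding g_def by (simp add: inner_diff_right algebra_simps)
    finally show ?thesis by (simp add: h_def)
  qed
  have "h = 0"
  proof (rule ccontr)
    assume "h \<noteq> 0"
    define a where "a = h \<bullet> h"
    define c where "c = - g h"
    have a: "a > 0" using \<open>h \<noteq> 0\<close> by (simp add: a_def)
    have c: "c \<ge> 0" using g_le[OF hU] by (simp add: c_def)
    \<comment> \<open>Any positive \<open>t\<close> with \<open>t * c < a\<close> lets the linear
      gain \<open>2 * t * a\<close> beat the quadratic loss; the \<open>+ 1\<close> covers
      \<open>c = 0\<close>.\<close>
    define t where "t = a / (c + 1)"
    have t: "t > 0" "t * c < a" using a c by (auto simp: t_def field_simps)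
    have "2 * t * a - t\<^sup>2 * c \<le> 0"
      using g_le[of "x + t *\<^sub>R h"] expand[of t] x(1) hU U
      by (simp add: a_def c_def subspace_add subspace_scale)
    hence "t * (2 * a - t * c) \<le> 0" by (simp add: power2_eq_square algebra_simps)
    with t a show False by (simp add: mult_le_0_iff)
  qed
  thus ?thesis using x by (auto simp: h_def l_def)
qed

text \<open>Induction on the dimension: once an eigenvector is split off, self-adjointness keeps its
  orthogonal complement in \<open>U\<close> invariant. Subspaces are used because the type cannot
  shrink along with the dimension.\<close>

lemma self_adjoint_orthonormal_eigenbasis_subspace:
  fixes f :: "'a::euclidean_space \<Rightarrow> 'a"
  assumes f: "linear f" and sa: "\<And>x y. f x \<bullet> y = x \<bullet> f y"
    and "subspace U" and "\<And>x. x \<in> U \<Longrightarrow> f x \<in> U"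
  shows "\<exists>B\<subseteq>U. pairwise orthogonal B \<and> (\<forall>b\<in>B. norm b = 1 \<and> f b = (b \<bullet> f b) *\<^sub>R b) \<and> span B = U"
  using assms(3,4)
proof (induction "dim U" arbitrary: U rule: less_induct)
  case less
  show ?case
  proof (cases "U = {0}")
    case True
    thus ?thesis by (intro exI[of _ "{}"]) auto
  next
    case False
    then obtain x where x: "x \<in> U" "norm x = 1" "f x = (x \<bullet> f x) *\<^sub>R x"
      using self_adjoint_max_eigenvector[OF f sa less.prems] by blast
    define U' where "U' = U \<inter> {u. x \<bullet> u = 0}"
    have U': "subspace U'"
      unfolding U'_def using less.prems(1) by (intro subspace_inter subspace_hyperplane)
    have "x \<notin> U'" using x by (auto simp: U'_def)
    hence "U' \<subset> U" using x unfolding U'_def by blast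
    hence "dim U' < dim U"
      using dim_psubset[of U' U] U' less.prems(1) span_eq_iff by metis
    moreover have "f u \<in> U'" if "u \<in> U'" for u
    proof -
      have "x \<bullet> f u = (x \<bullet> f x) * (x \<bullet> u)"
        by (metis sa x(3) inner_scaleR_left)
      thus ?thesis using that less.prems by (auto simp: U'_def)
    qed
    ultimately obtain B where B: "B \<subseteq> U'" "pairwise orthogonal B"
      "\<forall>b\<in>B. norm b = 1 \<and> f b = (b \<bullet> f b) *\<^sub>R b" "span B = U'"
      using less.hyps U' by blast
    have "pairwise orthogonal (insert x B)"
      using B by (auto simp: pairwise_insert U'_def orthogonal_def inner_commute)
    moreover have "span (insert x B) = U"
    proof
      show "span (insert x B) \<subseteq> U"
        using x B less.prems(1) by (intro span_minimal) (auto simp: U'_def)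
      show "U \<subseteq> span (insert x B)"
      proof
        fix u assume u: "u \<in> U"
        have "u - (x \<bullet> u) *\<^sub>R x \<in> U'"
          using u x less.prems(1)
          by (auto simp: U'_def subspace_diff subspace_scale inner_diff_right dot_square_norm)
        thus "u \<in> span (insert x B)" using B(4) by (auto simp: span_breakdown_eq)
      qed
    qed
    moreover have "insert x B \<subseteq> U" using B(1) x by (auto simp: U'_def)
    ultimately show ?thesis using B(3) x by (intro exI[of _ "insert x B"]) auto
  qed
qed

lemma matrix_selfadjoint: "sym_mat A \<Longrightarrow> (A *v x) \<bullet> y = x \<bullet> (A *v y)"
  by (metis dot_lmul_matrix sym_mat_def vector_transpose_matrix inner_commute)

definition diag :: "('n \<Rightarrow> real) \<Rightarrow> real^'n^'n" where
  "diag d = (\<chi> i j. if i = j then d i else 0)"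

lemma diag_mult_vec: "diag d *v x = (\<chi> i. d i * x $ i)"
  by (simp add: vec_eq_iff diag_def matrix_vector_mult_def if_distribR sum.delta' if_distrib[of "\<lambda>a. a * _"] cong: if_cong)

lemma diag_mult: "diag d ** diag e = diag (\<lambda>i. d i * e i)"
  by (auto simp: vec_eq_iff diag_def matrix_matrix_mult_def if_distrib[of "\<lambda>a. a * _"] cong: if_cong)

lemma transpose_diag [simp]: "transpose (diag d) = diag d"
  by (auto simp add: vec_eq_iff diag_def transpose_def)

lemma det_diag: "det (diag d) = (\<Prod>i\<in>UNIV. d i)"
  by (subst det_diagonal) (auto simp: diag_def)

lemma diag_1: "diag (\<lambda>_. 1) = mat 1"
  by (simp add: diag_def mat_def)

lemma symmetric_diagonalization:
  fixes A :: "real^'n^'n"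
  assumes A: "sym_mat A"
  obtains Q :: "real^'n^'n" and d where "transpose Q ** Q = mat 1" "Q ** transpose Q = mat 1" "transpose Q ** A ** Q = diag d"
proof -
  obtain B where B: "pairwise orthogonal B" "\<forall>b\<in>B. norm b = 1 \<and> A *v b = (b \<bullet> (A *v b)) *\<^sub>R b"
      "span B = (UNIV :: (real^'n) set)"
    using self_adjoint_orthonormal_eigenbasis_subspace[of "(*v) A" UNIV] matrix_selfadjoint[OF A] by auto
  have ind: "independent B"
    using B by (intro pairwise_orthogonal_independent) auto
  \<comment> \<open>The eigenbasis has as many elements as the index type, so its members can become
    the columns of a square matrix.\<close>
  have "card B = CARD('n)"
    using dim_eq_card[OF _ ind, of UNIV] B(3) by simp
  then obtain e :: "'n \<Rightarrow> real^'n" where e: "bij_betw e UNIV B"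
    by (metis finite_same_card_bij finite_class.finite_UNIV ind independent_imp_finite)
  have ee: "e i \<bullet> e j = (if i = j then 1 else 0)" for i j
  proof (cases "i = j")
    case True
    have "e i \<in> B" using e by (auto simp: bij_betw_def)
    thus ?thesis using True B(2) by (simp add: dot_square_norm)
  next
    case False
    have "e i \<in> B" "e j \<in> B" "e i \<noteq> e j" using e False by (auto simp: bij_betw_def inj_eq)
    thus ?thesis using False B(1) by (auto simp: pairwise_def orthogonal_def)
  qed
  define Q :: "real^'n^'n" where "Q = (\<chi> i j. e j $ i)"
  define d where "d i = e i \<bullet> (A *v e i)" for i
  have eig: "A *v e j = d j *\<^sub>R e j" for j
    using B(2) e by (auto simp: d_def bij_betw_def)
  have QQ: "transpose Q ** Q = mat 1"
    using ee by (simp add: vec_eq_iff Q_def matrix_matrix_mult_def transpose_def mat_def inner_vec_def)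
  have AQ: "A ** Q = Q ** diag d"
  proof -
    have "(A ** Q) $ i $ j = (A *v e j) $ i" for i j
      by (simp add: Q_def matrix_matrix_mult_def matrix_vector_mult_def)
    moreover have "(Q ** diag d) $ i $ j = d j * e j $ i" for i j
      by (simp add: Q_def diag_def matrix_matrix_mult_def if_distrib sum.delta cong: if_cong)
    ultimately show ?thesis by (simp add: vec_eq_iff eig)
  qed
  show ?thesis
  proof (rule that[OF QQ])
    show "Q ** transpose Q = mat 1" using QQ matrix_left_right_inverse by blast
    show "transpose Q ** A ** Q = diag d"
      by (metis AQ QQ matrix_mul_assoc matrix_mul_lid)
  qed
qed

section \<open>Definiteness, congruence and simultaneous diagonalization\<close>

lemma inner_matrix_vector_mult: "x \<bullet> (A *v y) = (transpose A *v x) \<bullet> (y :: real^'n)"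
  for A :: "real^'n^'m"
  by (simp add: dot_lmul_matrix)

lemma inner_congruence:
  fixes A :: "real^'m^'m" and R :: "real^'n^'m"
  shows "u \<bullet> ((transpose R ** A ** R) *v u) = (R *v u) \<bullet> (A *v (R *v u))"
  by (metis dot_lmul_matrix inner_commute matrix_vector_mul_assoc transpose_matrix_vector)

lemma sym_mat_congruence:
  fixes A :: "real^'m^'m" and R :: "real^'n^'m"
  shows "sym_mat A \<Longrightarrow> sym_mat (transpose R ** A ** R)"
  by (simp add: sym_mat_def matrix_transpose_mul matrix_mul_assoc)

lemma inner_diag: "u \<bullet> (diag d *v u) = (\<Sum>i\<in>UNIV. d i * (u $ i)\<^sup>2)"
  by (simp add: diag_mult_vec inner_vec_def power2_eq_square algebra_simps)

text \<open>Each \<open>d i\<close> is the quadratic form of \<open>A\<close> at the image of an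
  axis vector under \<open>R\<close>, which is nonzero. Allowing any invertible \<open>R\<close>
  covers the eigenvalues of one matrix as well as those of a pencil.\<close>

lemma pos_def_congruence_diag:
  fixes A :: "real^'n^'n"
  assumes A: "pos_def A" and inv: "invertible R" and d: "transpose R ** A ** R = diag d"
  shows "d (i::'n) > 0"
proof -
  let ?e = "axis i 1 :: real^'n"
  have "R *v ?e \<noteq> 0"
    using inv by (metis axis_eq_0_iff invertible_def matrix_vector_mul_assoc matrix_vector_mul_lid mult.commute
        matrix_vector_mult_0_right one_neq_zero)
  hence "?e \<bullet> (diag d *v ?e) > 0"
    using A inner_congruence[of ?e R A] by (simp add: pos_def_def d)
  moreover have "?e \<bullet> (diag d *v ?e) = d i"
    by (simp add: diag_mult_vec inner_axis' )
  ultimately show ?thesis by simp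
qed

lemma pos_def_diagonalization:
  fixes A :: "real^'n^'n"
  assumes A: "pos_def A"
  obtains Q :: "real^'n^'n" and d where "transpose Q ** Q = mat 1" "Q ** transpose Q = mat 1"
    "transpose Q ** A ** Q = diag d" "\<And>i. d i > 0" "det A = (\<Prod>i\<in>UNIV. d i)"
proof -
  obtain Q :: "real^'n^'n" and d where Q: "transpose Q ** Q = mat 1" "Q ** transpose Q = mat 1"
    "transpose Q ** A ** Q = diag d"
    using symmetric_diagonalization A unfolding pos_def_def by blast
  have "invertible Q" using Q by (auto simp: invertible_def)
  moreover have "det A = (\<Prod>i\<in>UNIV. d i)"
  proof -
    have "(\<Prod>i\<in>UNIV. d i) = det (transpose Q ** A ** Q)" by (simp add: Q det_diag)
    also have "\<dots> = det (transpose Q ** Q) * det A" by (simp add: det_mul mult_ac)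
    finally show ?thesis by (simp add: Q)
  qed
  ultimately show ?thesis using that[of Q d] Q pos_def_congruence_diag[OF A _ Q(3)] by blast
qed

lemma pos_def_det_pos: "pos_def A \<Longrightarrow> det A > 0"
  by (metis pos_def_diagonalization prod_pos)

lemma pos_def_invertible: "pos_def A \<Longrightarrow> invertible A"
  using pos_def_det_pos[of A] by (simp add: invertible_det_nz)

text \<open>The eigenvalues are nonnegative and their product is the nonzero determinant. This is
  how invertibility of \<open>V\<^sub>t\<close> becomes definiteness.\<close>

lemma pos_semidef_invertible_imp_pos_def:
  fixes A :: "real^'n^'n"
  assumes A: "pos_semidef A" and inv: "invertible A"
  shows "pos_def A"
  unfolding pos_def_def
proof (intro conjI allI impI)
  show sym: "sym_mat A" using A by (simp add: pos_semidef_def)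
  fix x :: "real^'n" assume x: "x \<noteq> 0"
  obtain Q :: "real^'n^'n" and d where Q: "transpose Q ** Q = mat 1" "Q ** transpose Q = mat 1"
    "transpose Q ** A ** Q = diag d"
    using symmetric_diagonalization[OF sym] by blast
  define u where "u = transpose Q *v x"
  have xu: "x = Q *v u" by (simp add: u_def matrix_vector_mul_assoc Q del: transpose_matrix_vector)
  have "(\<Prod>i\<in>UNIV. d i) = det (transpose Q ** A ** Q)" by (simp add: Q det_diag)
  also have "\<dots> = det (transpose Q ** Q) * det A" by (simp add: det_mul mult_ac)
  finally have nz: "(\<Prod>i\<in>UNIV. d i) \<noteq> 0" using inv by (simp add: Q invertible_det_nz)
  have "d i \<ge> 0" for i
  proof -
    have "axis i 1 \<bullet> (diag d *v axis i 1) \<ge> 0"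
      using A inner_congruence[of "axis i 1" Q A] by (simp add: pos_semidef_def Q)
    thus ?thesis by (simp add: diag_mult_vec inner_axis')
  qed
  with nz have d: "d i > 0" for i by (simp add: order_le_less)
  obtain i where i: "u $ i \<noteq> 0" using x xu by (metis matrix_vector_mult_0_right vec_eq_iff zero_index)
  have "(\<Sum>i\<in>UNIV. d i * (u $ i)\<^sup>2) > 0"
    using d i by (intro sum_pos2[of _ i]) (auto simp: less_imp_le)
  thus "x \<bullet> (A *v x) > 0"
    using inner_congruence[of u Q A] inner_diag[of u d] by (simp add: Q xu)
qed

lemma matrix_inv_mult:
  assumes "invertible A" shows "A ** matrix_inv A = mat 1" "matrix_inv A ** A = mat 1"
  using someI_ex[OF assms[unfolded invertible_def]] by (auto simp: matrix_inv_def)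

lemma matrix_inv_eqI:
  fixes A :: "real^'n^'n"
  assumes "B ** A = mat 1" shows "matrix_inv A = B"
proof -
  have "invertible A" using assms by (auto simp: invertible_left_inverse)
  thus ?thesis by (metis assms matrix_inv_mult matrix_mul_assoc matrix_mul_lid matrix_mul_rid)
qed

text \<open>First \<open>V\<close> is whitened by \<open>R\<close>, its eigenvector matrix rescaled
  by the inverse square roots of the eigenvalues. Then an orthogonal \<open>Q'\<close> diagonalizes
  the transformed \<open>B\<close> and leaves the identity alone.\<close>

lemma simultaneous_diagonalization:
  fixes V B :: "real^'n^'n"
  assumes V: "pos_def V" and B: "sym_mat B"
  obtains S :: "real^'n^'n" and e where "invertible S"
    "transpose S ** V ** S = mat 1" "transpose S ** B ** S = diag e"
proof -
  obtain Q :: "real^'n^'n" and d where Q: "transpose Q ** Q = mat 1" "Q ** transpose Q = mat 1"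
    "transpose Q ** V ** Q = diag d" "\<And>i. d i > 0"
    using pos_def_diagonalization[OF V] by blast
  define D where "D = diag (\<lambda>i. 1 / sqrt (d i))"
  define R where "R = Q ** D"
  have d2: "1 / sqrt (d i) * d i * (1 / sqrt (d i)) = 1" for i
    using Q(4)[of i] by (simp add: real_div_sqrt)
  have "transpose R ** V ** R = D ** (transpose Q ** V ** Q) ** D"
    by (simp add: R_def D_def matrix_transpose_mul matrix_mul_assoc)
  also have "\<dots> = mat 1"
    unfolding Q(3) D_def diag_mult d2 diag_1 ..
  finally have R: "transpose R ** V ** R = mat 1" .
  obtain Q' :: "real^'n^'n" and e where Q': "transpose Q' ** Q' = mat 1"
    "transpose Q' ** (transpose R ** B ** R) ** Q' = diag e"
    using symmetric_diagonalization[OF sym_mat_congruence[OF B, of R]] by blast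
  define S where "S = R ** Q'"
  have 1: "transpose S ** V ** S = transpose Q' ** (transpose R ** V ** R) ** Q'"
    by (simp add: S_def matrix_transpose_mul matrix_mul_assoc)
  have 2: "transpose S ** B ** S = transpose Q' ** (transpose R ** B ** R) ** Q'"
    by (simp add: S_def matrix_transpose_mul matrix_mul_assoc)
  have 3: "transpose S ** V ** S = mat 1" by (simp add: 1 R Q')
  have "invertible S"
    unfolding invertible_def using 3 matrix_left_right_inverse by blast
  thus ?thesis using 3 2 Q' that by metis
qed

text \<open>Since \<open>spec_radius\<close> ranges over complex eigenvectors, identities between
  real matrices have to be transported to complex ones.\<close>

definition complex_mat :: "real^'n^'m \<Rightarrow> complex^'n^'m" where
  "complex_mat A = (\<chi> i j. complex_of_real (A $ i $ j))"

lemma complex_mat_mult: "complex_mat (A ** B) = complex_mat A ** complex_mat B"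
  by (simp add: complex_mat_def matrix_matrix_mult_def vec_eq_iff)

lemma complex_mat_1: "complex_mat (mat 1) = mat 1"
  by (simp add: complex_mat_def mat_def vec_eq_iff)

lemma complex_mat_diag_mult_vec: "complex_mat (diag d) *v u = (\<chi> i. complex_of_real (d i) * u $ i)"
proof -
  have "complex_of_real (if i = j then d i else 0) * u $ j = (if j = i then complex_of_real (d i) * u $ i else 0)" for i j
    by simp
  thus ?thesis by (simp add: complex_mat_def diag_def matrix_vector_mult_def vec_eq_iff)
qed

text \<open>The eigenvalues of \<open>V\<inverse> B\<close> are those of the pencil \<open>B - l V\<close>, whose largest one is the maximum
  of the Rayleigh quotient.\<close>
lemma spec_radius_le_iff:
  fixes V B :: "real^'n^'n"
  assumes V: "pos_def V" and B: "pos_def B"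
  shows "spec_radius (matrix_inv V ** B) \<le> r \<longleftrightarrow> (\<forall>x. x \<bullet> (B *v x) \<le> r * (x \<bullet> (V *v x)))"
proof -
  obtain S :: "real^'n^'n" and e where S: "invertible S"
    "transpose S ** V ** S = mat 1" "transpose S ** B ** S = diag e"
    using simultaneous_diagonalization[OF V] B unfolding pos_def_def by blast
  have e: "e i > 0" for i by (rule pos_def_congruence_diag[OF B S(1,3)])
  let ?C = "matrix_inv V ** B"
  let ?S' = "transpose S ** V"
  have S': "S ** ?S' = mat 1" "?S' ** S = mat 1"
    using S(2) matrix_left_right_inverse by blast+
  have "matrix_inv V = S ** transpose S"
    using S' by (intro matrix_inv_eqI) (metis matrix_left_right_inverse matrix_mul_assoc)
  \<comment> \<open>The product \<open>?C\<close> need not be symmetric, but \<open>S\<close>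
    conjugates it to a real diagonal matrix, which leaves no room for other complex
    eigenvalues.\<close>
  hence "?C ** S = S ** (transpose S ** B ** S)" by (simp add: matrix_mul_assoc)
  hence CS: "?C ** S = S ** diag e" by (simp add: S)
  have "(\<exists>v. v \<noteq> 0 \<and> complex_mat ?C *v v = l *s v) \<longleftrightarrow> (\<exists>i. l = complex_of_real (e i))" for l
  proof
    assume "\<exists>v. v \<noteq> 0 \<and> complex_mat ?C *v v = l *s v"
    then obtain v where v: "v \<noteq> 0" "complex_mat ?C *v v = l *s v" by blast
    define u where "u = complex_mat ?S' *v v"
    have vu: "v = complex_mat S *v u"
      by (simp add: u_def matrix_vector_mul_assoc complex_mat_mult[symmetric] S' complex_mat_1)
    have "complex_mat (diag e) *v u = complex_mat (?S' ** (?C ** S)) *v u"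
      by (simp add: CS matrix_mul_assoc S')
    also have "\<dots> = complex_mat ?S' *v (complex_mat ?C *v v)"
      by (simp add: vu complex_mat_mult matrix_vector_mul_assoc matrix_mul_assoc)
    also have "\<dots> = l *s u" by (simp add: v u_def vector_scalar_commute)
    finally have "complex_of_real (e i) * u $ i = l * u $ i" for i
      by (simp add: complex_mat_diag_mult_vec vec_eq_iff)
    moreover obtain i where "u $ i \<noteq> 0"
      using v(1) vu by (metis matrix_vector_mult_0_right vec_eq_iff zero_index)
    ultimately show "\<exists>i. l = complex_of_real (e i)" by (metis mult_right_cancel)
  next
    assume "\<exists>i. l = complex_of_real (e i)"
    then obtain i where l: "l = complex_of_real (e i)" by blast
    let ?u = "axis i 1 :: complex^'n"
    define v where "v = complex_mat S *v ?u"
    have uv: "?u = complex_mat ?S' *v v"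
      by (simp only: v_def matrix_vector_mul_assoc complex_mat_mult[symmetric] S' complex_mat_1 matrix_vector_mul_lid)
    have "v \<noteq> 0" using uv by (metis axis_eq_0_iff matrix_vector_mult_0_right one_neq_zero)
    moreover have "complex_mat (diag e) *v ?u = l *s ?u"
      by (auto simp: complex_mat_diag_mult_vec vec_eq_iff axis_def l)
    hence "complex_mat S *v (complex_mat (diag e) *v ?u) = l *s v"
      by (simp add: v_def vector_scalar_commute)
    hence "complex_mat ?C *v v = l *s v"
      by (simp add: v_def matrix_vector_mul_assoc complex_mat_mult[symmetric] CS)
    ultimately show "\<exists>v. v \<noteq> 0 \<and> complex_mat ?C *v v = l *s v" by blast
  qed
  hence "{cmod l |l. \<exists>v::complex^'n. v \<noteq> 0 \<and> complex_mat ?C *v v = l *s v} = range e"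
    using e by (auto simp: less_imp_le abs_of_pos) (metis norm_of_real abs_of_pos e)
  \<comment> \<open>The maximum is over a finite nonempty set, and positivity of \<open>e\<close>
    has removed the modulus.\<close>
  hence "spec_radius ?C = Max (range e)"
    unfolding spec_radius_def complex_mat_def by simp
  hence "spec_radius ?C \<le> r \<longleftrightarrow> (\<forall>i. e i \<le> r)" by simp
  also have "\<dots> \<longleftrightarrow> (\<forall>u. (\<Sum>i\<in>UNIV. e i * (u $ i)\<^sup>2) \<le> r * (\<Sum>i\<in>UNIV. ((u::real^'n) $ i)\<^sup>2))"
  proof (intro iffI allI)
    fix u :: "real^'n" assume "\<forall>i. e i \<le> r"
    thus "(\<Sum>i\<in>UNIV. e i * (u $ i)\<^sup>2) \<le> r * (\<Sum>i\<in>UNIV. (u $ i)\<^sup>2)"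
      by (auto simp: sum_distrib_left intro!: sum_mono mult_right_mono)
  next
    fix i assume *: "\<forall>u. (\<Sum>i\<in>UNIV. e i * (u $ i)\<^sup>2) \<le> r * (\<Sum>i\<in>UNIV. ((u::real^'n) $ i)\<^sup>2)"
    show "e i \<le> r"
      using *[rule_format, of "axis i 1"]
      by (simp add: axis_def if_distrib[of "\<lambda>x. x\<^sup>2"] if_distrib[of "\<lambda>x. _ * x"] cong: if_cong)
  qed
  also have "\<dots> \<longleftrightarrow> (\<forall>u. (S *v u) \<bullet> (B *v (S *v u)) \<le> r * ((S *v u) \<bullet> (V *v (S *v u))))"
  proof -
    have "(S *v u) \<bullet> (B *v (S *v u)) = (\<Sum>i\<in>UNIV. e i * (u $ i)\<^sup>2)" for u
      using inner_congruence[of u S B] by (simp add: S inner_diag)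
    moreover have "(S *v u) \<bullet> (V *v (S *v u)) = (\<Sum>i\<in>UNIV. (u $ i)\<^sup>2)" for u
      using inner_congruence[of u S V] by (simp add: S inner_vec_def power2_eq_square)
    ultimately show ?thesis by simp
  qed
  also have "\<dots> \<longleftrightarrow> (\<forall>x. x \<bullet> (B *v x) \<le> r * (x \<bullet> (V *v x)))"
    using S' by (metis matrix_vector_mul_assoc matrix_vector_mul_lid)
  finally show ?thesis .
qed

subsection \<open>Gaussian integrals\<close>

lemma nn_integral_lborel_translation:
  fixes f :: "'a::euclidean_space \<Rightarrow> ennreal"
  assumes [measurable]: "f \<in> borel_measurable borel"
  shows "(\<integral>\<^sup>+x. f (x + a) \<partial>lborel) = (\<integral>\<^sup>+x. f x \<partial>lborel)"
proof -
  have "(\<integral>\<^sup>+x. f x \<partial>lborel) = (\<integral>\<^sup>+x. f x \<partial>distr lborel borel ((+) a))"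
    by (simp add: lborel_distr_plus)
  also have "\<dots> = (\<integral>\<^sup>+x. f (x + a) \<partial>lborel)"
    by (subst nn_integral_distr) (auto simp: add.commute)
  finally show ?thesis ..
qed

text \<open>Uniqueness of Haar measure: the image of Lebesgue measure under an isometry is translation
  invariant and agrees with Lebesgue measure on the unit ball.\<close>
lemma nn_integral_lborel_isometry:
  fixes f :: "'a::euclidean_space \<Rightarrow> ennreal" and g h :: "'a \<Rightarrow> 'a"
  assumes f[measurable]: "f \<in> borel_measurable borel"
    and g: "linear g" "\<And>x. norm (g x) = norm x" and h: "\<And>x. g (h x) = x"
  shows "(\<integral>\<^sup>+x. f (g x) \<partial>lborel) = (\<integral>\<^sup>+x. f x \<partial>lborel)"
proof -
  \<comment> \<open>What matters about the unit ball is that its indicator depends on the norm alone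
    and has finite positive mass.\<close>
  define b :: "'a \<Rightarrow> ennreal" where "b x = indicator (ball 0 1) x" for x
  have [measurable]: "b \<in> borel_measurable borel"
    unfolding b_def by (intro borel_measurable_indicator) simp
  have [measurable]: "g \<in> borel_measurable borel"
    using g(1) by (intro borel_measurable_continuous_onI linear_continuous_on) (simp add: linear_linear)
  have bint: "(\<integral>\<^sup>+x. b x \<partial>lborel) = emeasure lborel (ball (0::'a) 1)"
    by (simp add: b_def[abs_def])
  have bfin: "(\<integral>\<^sup>+x. b x \<partial>lborel) \<noteq> \<infinity>"
    unfolding bint using emeasure_lborel_ball_finite[of "0::'a" 1] by simp
  have "ennreal 0 < emeasure lborel (ball (0::'a) 1)"
  proof -
    have "\<not> negligible (ball (0::'a) 1)"
      by (simp add: open_not_negligible)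
    hence "emeasure lborel (ball (0::'a) 1) \<noteq> 0"
      by (auto simp: negligible_iff_null_sets null_sets_def)
    thus ?thesis by (simp add: zero_less_iff_neq_zero)
  qed
  hence bpos: "(\<integral>\<^sup>+x. b x \<partial>lborel) \<noteq> 0" unfolding bint by simp
  have tr: "(\<integral>\<^sup>+x. f (g x + y) \<partial>lborel) = (\<integral>\<^sup>+x. f (g x) \<partial>lborel)" for y
    using nn_integral_lborel_translation[of "\<lambda>x. f (g x)" "h y"] g(1) h
    by (simp add: linear_add)
  have refl: "(\<integral>\<^sup>+x. b (y - g x) \<partial>lborel) = (\<integral>\<^sup>+x. b x \<partial>lborel)" for y
  proof -
    have "norm (y - g x) = norm (x + - h y)" for x
    proof -
      have "y - g x = g (h y - x)" using g(1) h by (simp add: linear_diff)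
      thus ?thesis by (simp add: g norm_minus_commute)
    qed
    hence "b (y - g x) = b (x + - h y)" for x by (simp add: b_def indicator_def)
    thus ?thesis using nn_integral_lborel_translation[of b "- h y"] by simp
  qed
  \<comment> \<open>After multiplication by the mass of \<open>b\<close>, its variable
    \<open>y\<close> shifts the argument of \<open>f\<close>. Exchanging the integrals and
    substituting \<open>y - g x\<close> for \<open>y\<close> moves \<open>g\<close> from
    \<open>f\<close> to \<open>b\<close>, where it does no harm; the mass is cancelled at the
    end.\<close>
  have "(\<integral>\<^sup>+x. b x \<partial>lborel) * (\<integral>\<^sup>+x. f (g x) \<partial>lborel)
      = (\<integral>\<^sup>+y. b y * (\<integral>\<^sup>+x. f (g x) \<partial>lborel) \<partial>lborel)"
    by (simp add: nn_integral_multc)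
  also have "\<dots> = (\<integral>\<^sup>+y. b y * (\<integral>\<^sup>+x. f (g x + y) \<partial>lborel) \<partial>lborel)"
    by (simp add: tr)
  also have "\<dots> = (\<integral>\<^sup>+y. (\<integral>\<^sup>+x. b y * f (g x + y) \<partial>lborel) \<partial>lborel)"
    by (simp add: nn_integral_cmult)
  also have "\<dots> = (\<integral>\<^sup>+x. (\<integral>\<^sup>+y. b y * f (g x + y) \<partial>lborel) \<partial>lborel)"
    by (intro lborel_pair.Fubini') measurable
  also have "\<dots> = (\<integral>\<^sup>+x. (\<integral>\<^sup>+y. b (y - g x) * f y \<partial>lborel) \<partial>lborel)"
  proof (rule nn_integral_cong)
    fix x
    show "(\<integral>\<^sup>+y. b y * f (g x + y) \<partial>lborel) = (\<integral>\<^sup>+y. b (y - g x) * f y \<partial>lborel)"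
      using nn_integral_lborel_translation[of "\<lambda>y. b (y - g x) * f y" "g x"] by (simp add: add.commute)
  qed
  also have "\<dots> = (\<integral>\<^sup>+y. (\<integral>\<^sup>+x. b (y - g x) * f y \<partial>lborel) \<partial>lborel)"
    by (intro lborel_pair.Fubini'[symmetric]) measurable
  also have "\<dots> = (\<integral>\<^sup>+y. (\<integral>\<^sup>+x. b x \<partial>lborel) * f y \<partial>lborel)"
    by (simp add: nn_integral_multc refl)
  also have "\<dots> = (\<integral>\<^sup>+x. b x \<partial>lborel) * (\<integral>\<^sup>+y. f y \<partial>lborel)"
    by (simp add: nn_integral_cmult)
  finally show ?thesis using bfin bpos by (simp add: ennreal_mult_cancel_left)
qed

lemma nn_integral_gaussian:
  assumes d: "d > 0"
  shows "(\<integral>\<^sup>+x. ennreal (exp (- (d * x\<^sup>2) / 2)) \<partial>lborel) = ennreal (sqrt (2 * pi / d))"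
proof -
  define s where "s = 1 / sqrt d"
  have s: "s > 0" "s\<^sup>2 = 1 / d" using d by (auto simp: s_def power_divide)
  have "exp (- (d * x\<^sup>2) / 2) = sqrt (2 * pi / d) * normal_density 0 s x" for x
    using d by (simp add: normal_density_def s(2))
  hence "(\<integral>\<^sup>+x. ennreal (exp (- (d * x\<^sup>2) / 2)) \<partial>lborel)
      = (\<integral>\<^sup>+x. ennreal (sqrt (2 * pi / d)) * ennreal (normal_density 0 s x) \<partial>lborel)"
    using d by (simp add: ennreal_mult')
  also have "\<dots> = ennreal (sqrt (2 * pi / d)) * (\<integral>\<^sup>+x. ennreal (normal_density 0 s x) \<partial>lborel)"
    by (rule nn_integral_cmult) simp
  also have "(\<integral>\<^sup>+x. ennreal (normal_density 0 s x) \<partial>lborel) = 1"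
    using prob_space.emeasure_space_1[OF prob_space_normal_density[OF s(1), of 0]]
    by (simp add: emeasure_density)
  finally show ?thesis by simp
qed

lemma borel_measurable_inner_matrix [measurable]:
  fixes A :: "real^'n^'n"
  shows "(\<lambda>x. x \<bullet> (A *v x)) \<in> borel_measurable borel"
  by (intro borel_measurable_continuous_onI continuous_intros)

lemma sqrt_prod: "sqrt (prod f A) = (\<Prod>i\<in>A. sqrt (f i))"
  by (induction A rule: infinite_finite_induct) (auto simp: real_sqrt_mult)

text \<open>The isometry given by the eigenbasis turns the form into a weighted sum of squares, and
  the integral factors into one-dimensional ones.\<close>

lemma nn_integral_gaussian_pos_def:
  fixes A :: "real^'n^'n"
  assumes A: "pos_def A"
  shows "(\<integral>\<^sup>+x. ennreal (exp (- (x \<bullet> (A *v x)) / 2)) \<partial>lborel)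
     = ennreal (sqrt ((2 * pi) ^ CARD('n) / det A))"
proof -
  obtain Q :: "real^'n^'n" and d where Q: "transpose Q ** Q = mat 1" "Q ** transpose Q = mat 1"
    "transpose Q ** A ** Q = diag d" "\<And>i. d i > 0" "det A = (\<Prod>i\<in>UNIV. d i)"
    using pos_def_diagonalization[OF A] by blast
  have Basis: "(Basis :: (real^'n) set) = (\<lambda>i. axis i 1) ` UNIV" "inj (\<lambda>i::'n. axis i (1::real))"
    by (auto simp: Basis_vec_def inj_on_def axis_eq_axis)
  \<comment> \<open>Product integration runs over \<open>Basis\<close> and not over indices, so the
    eigenvalue that belongs to \<open>b\<close> is read off as
    \<open>b \<bullet> (diag d *v b)\<close>.\<close>
  let ?f = "\<lambda>b t. exp (- ((b \<bullet> (diag d *v b)) * t\<^sup>2) / 2)"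
  have prod_Basis: "prod h (Basis :: (real^'n) set) = (\<Prod>i\<in>UNIV. h (axis i 1))"
    for h :: "_ \<Rightarrow> 'z::comm_monoid_mult"
    unfolding Basis(1) by (simp add: prod.reindex[OF Basis(2)])
  have axis: "axis i 1 \<bullet> (diag d *v axis i 1) = d i" for i
    by (simp add: diag_mult_vec inner_axis')
  have "(\<integral>\<^sup>+x. ennreal (exp (- (x \<bullet> (A *v x)) / 2)) \<partial>lborel)
     = (\<integral>\<^sup>+x. ennreal (exp (- ((Q *v x) \<bullet> (A *v (Q *v x))) / 2)) \<partial>lborel)"
  proof (rule nn_integral_lborel_isometry[where h="(*v) (transpose Q)", symmetric])
    show "norm (Q *v x) = norm x" for x
      using inner_congruence[of x Q "mat 1"] Q(1) by (simp add: norm_eq_sqrt_inner)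
    show "Q *v (transpose Q *v x) = x" for x
      by (simp add: matrix_vector_mul_assoc Q del: transpose_matrix_vector)
  qed auto
  also have "\<dots> = (\<integral>\<^sup>+x. (\<Prod>b\<in>Basis. ennreal (?f b (x \<bullet> b))) \<partial>lborel)"
  proof (rule nn_integral_cong)
    fix x :: "real^'n"
    have "(Q *v x) \<bullet> (A *v (Q *v x)) = (\<Sum>i\<in>UNIV. d i * (x $ i)\<^sup>2)"
      using inner_congruence[of x Q A] by (simp add: Q inner_diag)
    hence "exp (- ((Q *v x) \<bullet> (A *v (Q *v x))) / 2) = (\<Prod>i\<in>UNIV. exp (- (d i * (x $ i)\<^sup>2) / 2))"
      by (simp add: exp_sum[symmetric] sum_negf sum_divide_distrib)
    also have "\<dots> = (\<Prod>b\<in>Basis. ?f b (x \<bullet> b))"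
      by (simp add: prod_Basis axis inner_axis)
    finally show "ennreal (exp (- ((Q *v x) \<bullet> (A *v (Q *v x))) / 2)) = (\<Prod>b\<in>Basis. ennreal (?f b (x \<bullet> b)))"
      by (simp add: prod_ennreal)
  qed
  also have "\<dots> = (\<Prod>b\<in>(Basis :: (real^'n) set). (\<integral>\<^sup>+t. ennreal (?f b t) \<partial>lborel))"
    by (rule nn_integral_lborel_prod) auto
  also have "\<dots> = (\<Prod>i\<in>(UNIV::'n set). ennreal (sqrt (2 * pi / d i)))"
    unfolding prod_Basis axis nn_integral_gaussian[OF Q(4)] ..
  also have "\<dots> = ennreal (sqrt (\<Prod>i\<in>(UNIV::'n set). 2 * pi / d i))"
    using Q(4) by (subst prod_ennreal) (auto simp: sqrt_prod less_imp_le)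
  also have "(\<Prod>i\<in>(UNIV::'n set). 2 * pi / d i) = (2 * pi) ^ CARD('n) / det A"
    by (simp add: Q(5) prod_dividef)
  finally show ?thesis .
qed

text \<open>Writing the linear coefficient as \<open>A *v z\<close> makes \<open>z\<close> the peak
  of the integrand; completing the square and translating leaves the centred integral.\<close>

lemma nn_integral_gaussian_linear:
  fixes A :: "real^'n^'n"
  assumes A: "pos_def A"
  shows "(\<integral>\<^sup>+x. ennreal (exp (x \<bullet> (A *v z) - (x \<bullet> (A *v x)) / 2)) \<partial>lborel)
     = ennreal (exp ((z \<bullet> (A *v z)) / 2) * sqrt ((2 * pi) ^ CARD('n) / det A))"
proof -
  have sq: "x \<bullet> (A *v z) - (x \<bullet> (A *v x)) / 2
      = (z \<bullet> (A *v z)) / 2 + - ((x + - z) \<bullet> (A *v (x + - z))) / 2" for x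
  proof -
    have "z \<bullet> (A *v x) = x \<bullet> (A *v z)"
      using matrix_selfadjoint[of A] A by (metis inner_commute pos_def_def)
    thus ?thesis
      by (simp add: matrix_vector_mult_diff_distrib inner_diff_left inner_diff_right field_simps)
  qed
  have "(\<integral>\<^sup>+x. ennreal (exp (x \<bullet> (A *v z) - (x \<bullet> (A *v x)) / 2)) \<partial>lborel)
     = (\<integral>\<^sup>+x. ennreal (exp ((z \<bullet> (A *v z)) / 2)) *
          ennreal (exp (- ((x + - z) \<bullet> (A *v (x + - z))) / 2)) \<partial>lborel)"
    by (simp only: sq exp_add ennreal_mult' exp_ge_zero)
  also have "\<dots> = ennreal (exp ((z \<bullet> (A *v z)) / 2)) *
      (\<integral>\<^sup>+x. ennreal (exp (- ((x + - z) \<bullet> (A *v (x + - z))) / 2)) \<partial>lborel)"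
    by (intro nn_integral_cmult) measurable
  also have "(\<integral>\<^sup>+x. ennreal (exp (- ((x + - z) \<bullet> (A *v (x + - z))) / 2)) \<partial>lborel)
      = (\<integral>\<^sup>+x. ennreal (exp (- (x \<bullet> (A *v x)) / 2)) \<partial>lborel)"
    by (rule nn_integral_lborel_translation) measurable
  finally show ?thesis
    unfolding nn_integral_gaussian_pos_def[OF A] by (simp only: ennreal_mult' exp_ge_zero)
qed

subsection \<open>Supermartingales\<close>

text \<open>In place of a stopping time, the mass that has crossed the level is frozen at the value
  \<open>c\<close>, while the rest still carries \<open>X t\<close>; the total \<open>inv\<close>
  never exceeds \<open>K\<close>. The decrease in mean is assumed exactly on the events of no
  crossing so far.\<close>

lemma ville_inequality:
  fixes X :: "nat \<Rightarrow> 'a \<Rightarrow> ennreal"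
  assumes X[measurable]: "\<And>t. X t \<in> borel_measurable M"
    and init: "(\<integral>\<^sup>+\<omega>. X 0 \<omega> \<partial>M) \<le> K"
    and step: "\<And>t. (\<integral>\<^sup>+\<omega>. X (Suc t) \<omega> * indicator {\<omega>\<in>space M. \<forall>s\<le>t. X s \<omega> < c} \<omega> \<partial>M)
                 \<le> (\<integral>\<^sup>+\<omega>. X t \<omega> * indicator {\<omega>\<in>space M. \<forall>s\<le>t. X s \<omega> < c} \<omega> \<partial>M)"
  shows "c * emeasure M {\<omega>\<in>space M. \<exists>t. c \<le> X t \<omega>} \<le> K"
proof -
  define G where "G t = {\<omega>\<in>space M. \<forall>s\<le>t. X s \<omega> < c}" for t
  define H where "H t = {\<omega>\<in>space M. \<exists>s\<le>t. c \<le> X s \<omega>}" for t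
  have [measurable]: "G t \<in> sets M" "H t \<in> sets M" for t
    unfolding G_def H_def by measurable
  \<comment> \<open>Markov's inequality on \<open>B\<close>, except that the part below the level is
    kept for the next round.\<close>
  have split: "c * emeasure M {\<omega>\<in>B. c \<le> X t \<omega>} + (\<integral>\<^sup>+\<omega>. X t \<omega> * indicator {\<omega>\<in>B. X t \<omega> < c} \<omega> \<partial>M)
     \<le> (\<integral>\<^sup>+\<omega>. X t \<omega> * indicator B \<omega> \<partial>M)" if [measurable]: "B \<in> sets M" for t B
  proof -
    have B: "{\<omega>\<in>B. P \<omega>} = {\<omega>\<in>space M. P \<omega> \<and> \<omega> \<in> B}" for P
      using sets.sets_into_space[OF that] by auto
    have [measurable]: "{\<omega>\<in>B. c \<le> X t \<omega>} \<in> sets M" "{\<omega>\<in>B. X t \<omega> < c} \<in> sets M"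
      unfolding B by measurable
    have "c * emeasure M {\<omega>\<in>B. c \<le> X t \<omega>} + (\<integral>\<^sup>+\<omega>. X t \<omega> * indicator {\<omega>\<in>B. X t \<omega> < c} \<omega> \<partial>M)
       = (\<integral>\<^sup>+\<omega>. c * indicator {\<omega>\<in>B. c \<le> X t \<omega>} \<omega> + X t \<omega> * indicator {\<omega>\<in>B. X t \<omega> < c} \<omega> \<partial>M)"
      by (simp add: nn_integral_add nn_integral_cmult_indicator)
    also have "\<dots> \<le> (\<integral>\<^sup>+\<omega>. X t \<omega> * indicator B \<omega> \<partial>M)"
      by (intro nn_integral_mono) (auto simp: indicator_def)
    finally show ?thesis .
  qed
  have inv: "c * emeasure M (H t) + (\<integral>\<^sup>+\<omega>. X t \<omega> * indicator (G t) \<omega> \<partial>M) \<le> K" for t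
  proof (induction t)
    case 0
    have "H 0 = {\<omega>\<in>space M. c \<le> X 0 \<omega>}" "G 0 = {\<omega>\<in>space M. X 0 \<omega> < c}"
      by (auto simp: H_def G_def)
    moreover have "(\<integral>\<^sup>+\<omega>. X 0 \<omega> * indicator (space M) \<omega> \<partial>M) = (\<integral>\<^sup>+\<omega>. X 0 \<omega> \<partial>M)"
      by (intro nn_integral_cong) simp
    ultimately show ?case using split[of "space M" 0] init by simp
  next
    case (Suc t)
    have GS: "G (Suc t) = {\<omega>\<in>G t. X (Suc t) \<omega> < c}" by (auto simp: G_def le_Suc_eq)
    have HS: "H (Suc t) = H t \<union> {\<omega>\<in>G t. c \<le> X (Suc t) \<omega>}"
      unfolding G_def H_def le_Suc_eq not_le[symmetric] by blast
    have [measurable]: "{\<omega>\<in>G t. c \<le> X (Suc t) \<omega>} \<in> sets M"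
    proof -
      have "{\<omega>\<in>G t. c \<le> X (Suc t) \<omega>} = G t \<inter> {\<omega>\<in>space M. c \<le> X (Suc t) \<omega>}" by (auto simp: G_def)
      thus ?thesis by simp
    qed
    have "emeasure M (H (Suc t)) \<le> emeasure M (H t) + emeasure M {\<omega>\<in>G t. c \<le> X (Suc t) \<omega>}"
      unfolding HS by (intro emeasure_subadditive) auto
    hence "c * emeasure M (H (Suc t)) + (\<integral>\<^sup>+\<omega>. X (Suc t) \<omega> * indicator (G (Suc t)) \<omega> \<partial>M)
       \<le> c * emeasure M (H t) + (c * emeasure M {\<omega>\<in>G t. c \<le> X (Suc t) \<omega>}
         + (\<integral>\<^sup>+\<omega>. X (Suc t) \<omega> * indicator (G (Suc t)) \<omega> \<partial>M))"
      unfolding add.assoc[symmetric] distrib_left[symmetric] by (intro add_mono mult_left_mono) auto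
    also have "\<dots> \<le> c * emeasure M (H t) + (\<integral>\<^sup>+\<omega>. X (Suc t) \<omega> * indicator (G t) \<omega> \<partial>M)"
      unfolding GS by (intro add_left_mono split) simp
    also have "\<dots> \<le> c * emeasure M (H t) + (\<integral>\<^sup>+\<omega>. X t \<omega> * indicator (G t) \<omega> \<partial>M)"
      using step[of t] by (intro add_left_mono) (simp add: G_def)
    also have "\<dots> \<le> K" by (rule Suc.IH)
    finally show ?case .
  qed
  have "incseq H" by (intro incseq_SucI) (auto simp: H_def le_Suc_eq)
  hence "(SUP t. emeasure M (H t)) = emeasure M (\<Union>t. H t)"
    by (intro SUP_emeasure_incseq) auto
  moreover have "(\<Union>t. H t) = {\<omega>\<in>space M. \<exists>t. c \<le> X t \<omega>}" by (auto simp: H_def)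
  ultimately have "c * emeasure M {\<omega>\<in>space M. \<exists>t. c \<le> X t \<omega>} = (SUP t. c * emeasure M (H t))"
    by (simp add: SUP_mult_left_ennreal[symmetric])
  also have "\<dots> \<le> K"
  proof (rule SUP_least)
    fix t show "c * emeasure M (H t) \<le> K" 
      by (rule order_trans[OF add_increasing2[OF zero_le order_refl] inv[of t]])
  qed
  finally show ?thesis .
qed

section \<open>Conditional sub-Gaussian bounds in a random direction\<close>

context sigma_finite_subalgebra
begin

text \<open>A simple \<open>\<nu>\<close> has finitely many values, so finitely many null sets are
  involved. On each level set, which belongs to \<open>F\<close>, the direction is constant and the
  remaining weight can be pulled out of the conditional expectation.\<close>

lemma nn_integral_exp_inner_le_simple:
  fixes w \<nu> :: "'a \<Rightarrow> 'b::euclidean_space" and \<psi> :: "'b \<Rightarrow> real"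
  assumes [measurable]: "w \<in> borel_measurable M" "Z \<in> borel_measurable F"
    and sub: "\<And>v. AE \<omega> in M. nn_cond_exp M F (\<lambda>\<omega>. ennreal (exp (v \<bullet> w \<omega>))) \<omega> \<le> ennreal (exp (\<psi> v))"
    and \<nu>: "simple_function F \<nu>"
  shows "(\<integral>\<^sup>+\<omega>. Z \<omega> * ennreal (exp (\<nu> \<omega> \<bullet> w \<omega> - \<psi> (\<nu> \<omega>))) \<partial>M) \<le> (\<integral>\<^sup>+\<omega>. Z \<omega> \<partial>M)"
proof -
  have sp: "space F = space M" using subalg by (simp add: subalgebra_def)
  define R where "R = \<nu> ` space M"
  have fin: "finite R" using \<nu> by (simp add: simple_function_def R_def sp)
  define A where "A v = \<nu> -` {v} \<inter> space M" for v
  have AF[measurable]: "A v \<in> sets F" if "v \<in> R" for v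
    using \<nu> that by (auto simp: simple_function_def R_def A_def sp)
  have ZM[measurable]: "Z \<in> borel_measurable M"
    using assms(2) subalg by (rule measurable_from_subalg[rotated])
  have AM: "A v \<in> sets M" if "v \<in> R" for v
    using AF[OF that] subalg by (auto simp: subalgebra_def)
  have decomp: "f (\<nu> \<omega>) = (\<Sum>v\<in>R. indicator (A v) \<omega> * f v)" if "\<omega> \<in> space M" for f :: "'b \<Rightarrow> ennreal" and \<omega>
  proof -
    have "(\<Sum>v\<in>R. indicator (A v) \<omega> * f v) = (\<Sum>v\<in>R. if \<nu> \<omega> = v then f v else 0)"
      using that by (intro sum.cong) (auto simp: A_def indicator_def)
    thus ?thesis using fin that by (simp add: R_def)
  qed
  have "(\<integral>\<^sup>+\<omega>. Z \<omega> * ennreal (exp (\<nu> \<omega> \<bullet> w \<omega> - \<psi> (\<nu> \<omega>))) \<partial>M)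
      = (\<integral>\<^sup>+\<omega>. (\<Sum>v\<in>R. (Z \<omega> * indicator (A v) \<omega> * ennreal (exp (- \<psi> v))) * ennreal (exp (v \<bullet> w \<omega>))) \<partial>M)"
  proof (rule nn_integral_cong)
    fix \<omega> assume \<omega>: "\<omega> \<in> space M"
    show "Z \<omega> * ennreal (exp (\<nu> \<omega> \<bullet> w \<omega> - \<psi> (\<nu> \<omega>)))
      = (\<Sum>v\<in>R. (Z \<omega> * indicator (A v) \<omega> * ennreal (exp (- \<psi> v))) * ennreal (exp (v \<bullet> w \<omega>)))"
      unfolding decomp[OF \<omega>, of "\<lambda>v. ennreal (exp (v \<bullet> w \<omega> - \<psi> v))"] sum_distrib_left
      by (intro sum.cong) (simp_all add: mult.assoc ennreal_mult'[symmetric] exp_add[symmetric])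
  qed
  also have "\<dots> = (\<Sum>v\<in>R. (\<integral>\<^sup>+\<omega>. (Z \<omega> * indicator (A v) \<omega> * ennreal (exp (- \<psi> v))) * ennreal (exp (v \<bullet> w \<omega>)) \<partial>M))"
    using AM by (intro nn_integral_sum) simp
  also have "\<dots> = (\<Sum>v\<in>R. (\<integral>\<^sup>+\<omega>. (Z \<omega> * indicator (A v) \<omega> * ennreal (exp (- \<psi> v)))
      * nn_cond_exp M F (\<lambda>\<omega>. ennreal (exp (v \<bullet> w \<omega>))) \<omega> \<partial>M))"
    by (intro sum.cong nn_cond_exp_intg[symmetric]) auto
  also have "\<dots> \<le> (\<Sum>v\<in>R. (\<integral>\<^sup>+\<omega>. (Z \<omega> * indicator (A v) \<omega> * ennreal (exp (- \<psi> v))) * ennreal (exp (\<psi> v)) \<partial>M))"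
  proof (intro sum_mono nn_integral_mono_AE)
    fix v
    show "AE \<omega> in M. (Z \<omega> * indicator (A v) \<omega> * ennreal (exp (- \<psi> v)))
      * nn_cond_exp M F (\<lambda>\<omega>. ennreal (exp (v \<bullet> w \<omega>))) \<omega>
      \<le> (Z \<omega> * indicator (A v) \<omega> * ennreal (exp (- \<psi> v))) * ennreal (exp (\<psi> v))"
      using sub[of v] by eventually_elim (intro mult_left_mono, auto)
  qed
  also have "\<dots> = (\<Sum>v\<in>R. (\<integral>\<^sup>+\<omega>. Z \<omega> * (indicator (A v) \<omega> * 1) \<partial>M))"
    by (simp add: mult.assoc ennreal_mult'[symmetric] exp_add[symmetric])
  also have "\<dots> = (\<integral>\<^sup>+\<omega>. (\<Sum>v\<in>R. Z \<omega> * (indicator (A v) \<omega> * 1)) \<partial>M)"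
    using AM by (intro nn_integral_sum[symmetric]) simp
  also have "\<dots> = (\<integral>\<^sup>+\<omega>. Z \<omega> \<partial>M)"
    using decomp[of _ "\<lambda>_. 1"] by (intro nn_integral_cong) (simp add: sum_distrib_left[symmetric])
  finally show ?thesis .
qed

text \<open>Simple functions converge to \<open>\<nu>\<close> pointwise, and with them the
  integrands, by continuity of \<open>\<psi>\<close>. The bound is the same for every approximation,
  so Fatou's lemma suffices.\<close>

lemma nn_integral_exp_inner_le:
  fixes w \<nu> :: "'a \<Rightarrow> 'b::euclidean_space" and \<psi> :: "'b \<Rightarrow> real"
  assumes [measurable]: "w \<in> borel_measurable M" "Z \<in> borel_measurable F" "\<nu> \<in> borel_measurable F"
    and \<psi>: "continuous_on UNIV \<psi>"
    and sub: "\<And>v. AE \<omega> in M. nn_cond_exp M F (\<lambda>\<omega>. ennreal (exp (v \<bullet> w \<omega>))) \<omega> \<le> ennreal (exp (\<psi> v))"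
  shows "(\<integral>\<^sup>+\<omega>. Z \<omega> * ennreal (exp (\<nu> \<omega> \<bullet> w \<omega> - \<psi> (\<nu> \<omega>))) \<partial>M) \<le> (\<integral>\<^sup>+\<omega>. Z \<omega> \<partial>M)"
proof -
  have sp: "space F = space M" using subalg by (simp add: subalgebra_def)
  obtain s where s: "\<And>i. simple_function F (s i)"
    and lim: "\<And>\<omega>. \<omega> \<in> space M \<Longrightarrow> (\<lambda>i. s i \<omega>) \<longlonglongrightarrow> \<nu> \<omega>"
    using borel_measurable_implies_sequence_metric[OF assms(3), of 0] sp by auto
  have sF: "s i \<in> borel_measurable F" for i
    using s by (rule borel_measurable_simple_function)
  have [measurable]: "s i \<in> borel_measurable M" "Z \<in> borel_measurable M" for i
    by (rule measurable_from_subalg[OF subalg sF]) (rule measurable_from_subalg[OF subalg assms(2)])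
  have [measurable]: "\<psi> \<in> borel_measurable borel"
    using \<psi> by (rule borel_measurable_continuous_onI)
  let ?f = "\<lambda>v \<omega>. Z \<omega> * ennreal (exp (v \<bullet> w \<omega> - \<psi> v))"
  have "(\<integral>\<^sup>+\<omega>. ?f (\<nu> \<omega>) \<omega> \<partial>M) = (\<integral>\<^sup>+\<omega>. liminf (\<lambda>i. ?f (s i \<omega>) \<omega>) \<partial>M)"
  proof (rule nn_integral_cong)
    fix \<omega> assume "\<omega> \<in> space M"
    hence l: "(\<lambda>i. s i \<omega>) \<longlonglongrightarrow> \<nu> \<omega>" by (rule lim)
    have "(\<lambda>i. \<psi> (s i \<omega>)) \<longlonglongrightarrow> \<psi> (\<nu> \<omega>)"
      using continuous_on_tendsto_compose[OF \<psi> l] by simp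
    hence "(\<lambda>i. ennreal (exp (s i \<omega> \<bullet> w \<omega> - \<psi> (s i \<omega>)))) \<longlonglongrightarrow> ennreal (exp (\<nu> \<omega> \<bullet> w \<omega> - \<psi> (\<nu> \<omega>)))"
      by (intro tendsto_ennrealI tendsto_intros l)
    hence "(\<lambda>i. ?f (s i \<omega>) \<omega>) \<longlonglongrightarrow> ?f (\<nu> \<omega>) \<omega>"
      by (intro tendsto_mult_ennreal tendsto_const) auto
    thus "?f (\<nu> \<omega>) \<omega> = liminf (\<lambda>i. ?f (s i \<omega>) \<omega>)"
      by (simp add: lim_imp_Liminf)
  qed
  also have "\<dots> \<le> liminf (\<lambda>i. (\<integral>\<^sup>+\<omega>. ?f (s i \<omega>) \<omega> \<partial>M))"
    by (intro nn_integral_liminf) measurable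
  also have "\<dots> \<le> liminf (\<lambda>i. (\<integral>\<^sup>+\<omega>. Z \<omega> \<partial>M))"
    by (intro Liminf_mono always_eventually allI nn_integral_exp_inner_le_simple assms s)
  also have "\<dots> = (\<integral>\<^sup>+\<omega>. Z \<omega> \<partial>M)" by (simp add: Liminf_const)
  finally show ?thesis .
qed

end

section \<open>Measurability of matrix operations\<close>

lemma borel_measurable_vec_nth [measurable (raw)]:
  fixes f :: "'a \<Rightarrow> 'b::euclidean_space^'n"
  shows "f \<in> borel_measurable N \<Longrightarrow> (\<lambda>x. f x $ i) \<in> borel_measurable N"
  by (rule measurable_compose[of f N borel]) (auto intro!: borel_measurable_continuous_onI continuous_intros)

lemma borel_measurable_vecI:
  fixes f :: "'a \<Rightarrow> 'b::euclidean_space^'n"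
  assumes "\<And>i. (\<lambda>x. f x $ i) \<in> borel_measurable N"
  shows "f \<in> borel_measurable N"
  using assms by (subst borel_measurable_euclidean_space) (auto simp: Basis_vec_def inner_axis)

lemma borel_measurable_matrix_vector_mult [measurable (raw)]:
  fixes A :: "'a \<Rightarrow> real^'n^'m" and x :: "'a \<Rightarrow> real^'n"
  assumes [measurable]: "A \<in> borel_measurable N" "x \<in> borel_measurable N"
  shows "(\<lambda>w. A w *v x w) \<in> borel_measurable N"
  by (rule borel_measurable_vecI) (simp add: matrix_vector_mult_def)

lemma borel_measurable_matrix_matrix_mult [measurable (raw)]:
  fixes A :: "'a \<Rightarrow> real^'n^'m" and B :: "'a \<Rightarrow> real^'k^'n"
  assumes [measurable]: "A \<in> borel_measurable N" "B \<in> borel_measurable N"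
  shows "(\<lambda>w. A w ** B w) \<in> borel_measurable N"
  by (intro borel_measurable_vecI) (simp add: matrix_matrix_mult_def)

lemma borel_measurable_transpose [measurable (raw)]:
  fixes A :: "'a \<Rightarrow> real^'n^'m"
  assumes [measurable]: "A \<in> borel_measurable N"
  shows "(\<lambda>w. transpose (A w)) \<in> borel_measurable N"
  by (intro borel_measurable_vecI) (simp add: transpose_def)

lemma borel_measurable_det [measurable (raw)]:
  fixes A :: "'a \<Rightarrow> real^'n^'n"
  assumes [measurable]: "A \<in> borel_measurable N"
  shows "(\<lambda>w. det (A w)) \<in> borel_measurable N"
  unfolding det_def by measurable

subsection \<open>Regularized least squares\<close>

lemma inner_sym_mat_swap: "sym_mat A \<Longrightarrow> x \<bullet> (A *v y) = y \<bullet> (A *v x)"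
  by (metis matrix_selfadjoint inner_commute)

lemma quadratic_form_add:
  assumes "sym_mat A"
  shows "(x + z) \<bullet> (A *v (x + z)) = x \<bullet> (A *v x) + 2 * (z \<bullet> (A *v x)) + z \<bullet> (A *v z)"
  using inner_sym_mat_swap[OF assms, of x z]
  by (simp add: matrix_vector_right_distrib inner_add_left inner_add_right)

lemma matrix_vector_mult_minus_right: "A *v (- x) = - (A *v (x :: real^'n))"
  using matrix_vector_mult_diff_distrib[of A 0 x] by simp

lemma pos_def_imp_pos_semidef: "pos_def A \<Longrightarrow> pos_semidef A"
  unfolding pos_def_def pos_semidef_def by (metis inner_zero_left less_imp_le order_refl)

lemma pos_def_add_pos_semidef:
  assumes "pos_semidef A" "pos_def B"
  shows "pos_def (A + B)"
proof -
  have "sym_mat (A + B)"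
    using assms by (simp add: pos_def_def pos_semidef_def sym_mat_def transpose_def vec_eq_iff)
  thus ?thesis
    using assms unfolding pos_def_def pos_semidef_def
    by (simp add: matrix_vector_mult_add_rdistrib inner_add_right add_nonneg_pos)
qed

lemma wnorm_squared: "pos_semidef A \<Longrightarrow> (wnorm A x)\<^sup>2 = x \<bullet> (A *v x)"
  by (simp add: wnorm_def pos_semidef_def)

lemma matrix_vector_mult_sum_left: "sum A I *v x = (\<Sum>i\<in>I. A i *v (x::real^'n))"
  by (induction I rule: infinite_finite_induct) (auto simp: matrix_vector_mult_add_rdistrib)

lemma Vmat_mult_vec:
  "Vmat Mr W t \<omega> *v x = (\<Sum>k<t. transpose (Mr k \<omega>) *v (W *v (Mr k \<omega> *v x)))"
  by (simp add: Vmat_def matrix_vector_mult_sum_left matrix_vector_mul_assoc matrix_mul_assoc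
      del: transpose_matrix_vector)

lemma pos_semidef_Vmat:
  fixes Mr :: "nat \<Rightarrow> 'a \<Rightarrow> real^'n^'m"
  assumes "pos_semidef W"
  shows "pos_semidef (Vmat Mr W t \<omega>)"
proof -
  have "transpose (\<Sum>k<t. A k) = (\<Sum>k<t. transpose (A k))" for A :: "nat \<Rightarrow> real^'n^'n"
    by (induction t) (auto simp: transpose_def vec_eq_iff)
  moreover have "sym_mat (transpose (Mr k \<omega>) ** W ** Mr k \<omega>)" for k
    using assms by (intro sym_mat_congruence) (simp add: pos_semidef_def)
  ultimately have "sym_mat (Vmat Mr W t \<omega>)" by (simp add: sym_mat_def Vmat_def)
  moreover have "x \<bullet> (Vmat Mr W t \<omega> *v x) \<ge> 0" for x
    using assms unfolding Vmat_def matrix_vector_mult_sum_left inner_sum_right inner_congruence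
    by (intro sum_nonneg) (simp add: pos_semidef_def)
  ultimately show ?thesis by (simp add: pos_semidef_def)
qed

text \<open>The right-hand side of the normal equations, whose matrix is
  \<open>P + V\<^sub>t\<close>.\<close>

definition ls_rhs :: "(nat \<Rightarrow> 'a \<Rightarrow> real^'n^'m) \<Rightarrow> (nat \<Rightarrow> 'a \<Rightarrow> real^'m) \<Rightarrow> real^'m^'m
    \<Rightarrow> real^'n^'n \<Rightarrow> real^'n \<Rightarrow> nat \<Rightarrow> 'a \<Rightarrow> real^'n" where
  "ls_rhs Mr y W P \<mu> t \<omega> = P *v \<mu> + (\<Sum>k<t. transpose (Mr k \<omega>) *v (W *v y (Suc k) \<omega>))"

text \<open>The normal equations say that the gradient vanishes at \<open>\<theta>\<close>, so the
  linear term in \<open>h\<close> drops out of the quadratic cost. The expansion is exact, hence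
  good for minimality and for uniqueness.\<close>

lemma ls_cost_expand:
  assumes W: "pos_semidef W" and P: "pos_semidef P"
    and eq: "(P + Vmat Mr W t \<omega>) *v \<theta> = ls_rhs Mr y W P \<mu> t \<omega>"
  shows "ls_cost Mr y W P \<mu> t \<omega> (\<theta> + h) = ls_cost Mr y W P \<mu> t \<omega> \<theta> + h \<bullet> ((P + Vmat Mr W t \<omega>) *v h)"
proof -
  let ?r = "\<lambda>k. y (Suc k) \<omega> - Mr k \<omega> *v \<theta>"
  have P': "(wnorm P (\<theta> + h - \<mu>))\<^sup>2
      = (wnorm P (\<theta> - \<mu>))\<^sup>2 + 2 * (h \<bullet> (P *v (\<theta> - \<mu>))) + h \<bullet> (P *v h)"
    using quadratic_form_add[of P "\<theta> - \<mu>" h] P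
    by (simp add: wnorm_squared pos_semidef_def algebra_simps)
  have W': "(wnorm W (y (Suc k) \<omega> - Mr k \<omega> *v (\<theta> + h)))\<^sup>2
      = (wnorm W (?r k))\<^sup>2 - 2 * (h \<bullet> (transpose (Mr k \<omega>) *v (W *v ?r k)))
        + h \<bullet> (transpose (Mr k \<omega>) *v (W *v (Mr k \<omega> *v h)))" for k
  proof -
    have "y (Suc k) \<omega> - Mr k \<omega> *v (\<theta> + h) = ?r k + Mr k \<omega> *v (- h)"
      by (simp add: matrix_vector_right_distrib matrix_vector_mult_minus_right)
    show ?thesis
      unfolding \<open>y (Suc k) \<omega> - Mr k \<omega> *v (\<theta> + h) = ?r k + Mr k \<omega> *v (- h)\<close>
      using quadratic_form_add[of W "?r k" "Mr k \<omega> *v (- h)"] W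
      by (simp add: wnorm_squared pos_semidef_def inner_matrix_vector_mult[of h "transpose (Mr k \<omega>)"]
          matrix_vector_mult_minus_right del: transpose_matrix_vector)
  qed
  \<comment> \<open>This vector is half the gradient of the cost at \<open>\<theta>\<close>.\<close>
  have "(P *v (\<theta> - \<mu>)) - (\<Sum>k<t. transpose (Mr k \<omega>) *v (W *v ?r k)) = 0"
    using eq by (simp add: ls_rhs_def matrix_vector_mult_add_rdistrib Vmat_mult_vec matrix_vector_mult_diff_distrib
        sum_subtractf algebra_simps del: transpose_matrix_vector)
  from arg_cong[OF this, of "inner h"]
  have "h \<bullet> (P *v (\<theta> - \<mu>)) - (\<Sum>k<t. h \<bullet> (transpose (Mr k \<omega>) *v (W *v ?r k))) = 0"
    by (simp only: inner_diff_right[of h] inner_sum_right inner_zero_right)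
  moreover have "h \<bullet> ((P + Vmat Mr W t \<omega>) *v h)
      = h \<bullet> (P *v h) + (\<Sum>k<t. h \<bullet> (transpose (Mr k \<omega>) *v (W *v (Mr k \<omega> *v h))))"
    by (simp add: matrix_vector_mult_add_rdistrib Vmat_mult_vec inner_add_right inner_sum_right
        del: transpose_matrix_vector)
  ultimately show ?thesis
    unfolding ls_cost_def P' W' sum.distrib sum_subtractf sum_distrib_left[symmetric] by simp
qed

text \<open>Evaluating the definite description takes a unique minimizer; the expansion around the
  solution of the normal equations provides it, with uniqueness from definiteness.\<close>

lemma theta_hat_normal_equation:
  assumes W: "pos_semidef W" and P: "pos_semidef P" and H: "pos_def (P + Vmat Mr W t \<omega>)"
  shows "(P + Vmat Mr W t \<omega>) *v theta_hat Mr y W P \<mu> t \<omega> = ls_rhs Mr y W P \<mu> t \<omega>"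
proof -
  let ?H = "P + Vmat Mr W t \<omega>" and ?c = "ls_cost Mr y W P \<mu> t \<omega>"
  define \<theta> where "\<theta> = matrix_inv ?H *v ls_rhs Mr y W P \<mu> t \<omega>"
  have eq: "?H *v \<theta> = ls_rhs Mr y W P \<mu> t \<omega>"
    by (simp add: \<theta>_def matrix_vector_mul_assoc matrix_inv_mult pos_def_invertible[OF H])
  have cost: "?c \<theta>' = ?c \<theta> + (\<theta>' - \<theta>) \<bullet> (?H *v (\<theta>' - \<theta>))" for \<theta>'
    using ls_cost_expand[OF W P eq, of "\<theta>' - \<theta>"] by simp
  have "theta_hat Mr y W P \<mu> t \<omega> = \<theta>"
    unfolding theta_hat_def
  proof (rule the_equality)
    show "\<forall>\<theta>'. ?c \<theta> \<le> ?c \<theta>'"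
    proof
      fix \<theta>'
      have "0 \<le> (\<theta>' - \<theta>) \<bullet> (?H *v (\<theta>' - \<theta>))"
        using pos_def_imp_pos_semidef[OF H] by (simp add: pos_semidef_def)
      thus "?c \<theta> \<le> ?c \<theta>'" using cost[of \<theta>'] by linarith
    qed
    fix \<theta>' assume "\<forall>\<theta>''. ?c \<theta>' \<le> ?c \<theta>''"
    hence "(\<theta>' - \<theta>) \<bullet> (?H *v (\<theta>' - \<theta>)) \<le> 0" using cost[of \<theta>'] by (metis add_le_same_cancel1)
    moreover have "(\<theta>' - \<theta>) \<bullet> (?H *v (\<theta>' - \<theta>)) > 0" if "\<theta>' - \<theta> \<noteq> 0"
      using H that unfolding pos_def_def by blast
    ultimately show "\<theta>' = \<theta>" by fastforce
  qed
  with eq show ?thesis by simp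
qed

text \<open>The cross terms are absorbed by completing the square, separately in \<open>P\<close> and in \<open>V + B\<close>;
  the latter is at most \<open>1 + \<rho>\<close> times \<open>V\<close>.\<close>
lemma weighted_error_bound:
  fixes P V B :: "real^'n^'n"
  assumes P: "pos_semidef P" and V: "pos_def V" and B: "pos_def B"
    and eq: "(P + V) *v x = P *v e - (V + B) *v z"
  defines "\<rho> \<equiv> spec_radius (matrix_inv V ** B)"
  shows "0 \<le> \<rho>" "x \<bullet> ((P + V) *v x) \<le> e \<bullet> (P *v e) + (1 + \<rho>) * (z \<bullet> ((V + B) *v z))"
proof -
  have le: "x \<bullet> (B *v x) \<le> \<rho> * (x \<bullet> (V *v x))" for x
    using spec_radius_le_iff[OF V B, of \<rho>] by (simp add: \<rho>_def)
  \<comment> \<open>Some nonzero vector: its Rayleigh quotient is positive and at most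
    \<rho>.\<close>
  define u :: "real^'n" where "u = axis undefined 1"
  have "u \<noteq> 0" by (simp add: u_def axis_eq_0_iff)
  hence "u \<bullet> (B *v u) > 0" "u \<bullet> (V *v u) > 0" using V B unfolding pos_def_def by blast+
  thus \<rho>: "0 \<le> \<rho>" using le[of u] by (smt (verit) mult_neg_pos)
  define a where "a = 1 + \<rho>"
  have a: "a > 0" using \<rho> by (simp add: a_def)
  have A: "pos_semidef (V + B)"
    using V B by (intro pos_def_imp_pos_semidef pos_def_add_pos_semidef)
  let ?xA = "x \<bullet> ((V + B) *v x)" and ?zA = "z \<bullet> ((V + B) *v z)" and ?xz = "x \<bullet> ((V + B) *v z)"
  \<comment> \<open>With the weight \<open>a = 1 + \<rho>\<close> on \<open>z\<close>, every term
    has a factor \<open>a\<close> once the form of \<open>V + B\<close> at \<open>x\<close> is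
    bounded by \<open>a\<close> times that of \<open>V\<close>.\<close>
  have "0 \<le> (x + a *\<^sub>R z) \<bullet> ((V + B) *v (x + a *\<^sub>R z))" using A by (simp add: pos_semidef_def)
  also have "\<dots> = ?xA + 2 * a * ?xz + a\<^sup>2 * ?zA"
    using quadratic_form_add[of "V + B" x "a *\<^sub>R z"] A inner_sym_mat_swap[of "V + B" z x]
    by (simp add: pos_semidef_def matrix_vector_mult_scaleR power2_eq_square)
  also have "?xA \<le> a * (x \<bullet> (V *v x))"
    using le[of x] by (simp add: a_def matrix_vector_mult_add_rdistrib inner_add_right algebra_simps)
  finally have "0 \<le> a * (x \<bullet> (V *v x) + 2 * ?xz + a * ?zA)"
    by (simp add: power2_eq_square algebra_simps)
  hence 1: "0 \<le> x \<bullet> (V *v x) + 2 * ?xz + a * ?zA" using a by (simp add: zero_le_mult_iff)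
  have "0 \<le> (e + - x) \<bullet> (P *v (e + - x))" using P unfolding pos_semidef_def by blast
  also have "\<dots> = e \<bullet> (P *v e) - 2 * (x \<bullet> (P *v e)) + x \<bullet> (P *v x)"
    using quadratic_form_add[of P e "- x"] P by (simp add: pos_semidef_def matrix_vector_mult_minus_right)
  finally have 2: "0 \<le> \<dots>" .
  \<comment> \<open>When this identity is doubled and both squares are inserted, one copy of the
    left-hand side appears on the right and cancels.\<close>
  have "x \<bullet> ((P + V) *v x) = x \<bullet> (P *v e) - ?xz" by (simp add: eq inner_diff_right)
  with 1 2 show "x \<bullet> ((P + V) *v x) \<le> e \<bullet> (P *v e) + (1 + \<rho>) * ?zA"
    by (simp add: a_def matrix_vector_mult_add_rdistrib inner_add_right)
qed

text \<open>By the Rayleigh characterization, a sublevel set is cut out of the definite matrices by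
  one inequality linear in \<open>V\<close> for each \<open>x\<close>, hence by a closed set. The
  definite matrices themselves are the closed semidefinite cone without the zeros of the
  determinant.\<close>

lemma borel_measurable_spec_radius:
  fixes B :: "real^'n^'n"
  assumes B: "pos_def B"
  shows "(\<lambda>V. if pos_def V then spec_radius (matrix_inv V ** B) else 0) \<in> borel_measurable borel"
    (is "?f \<in> _")
    proof -
  have cl: "closed {V :: real^'n^'n. \<forall>x. a x \<le> r * (x \<bullet> (V *v x))}" for a r
    unfolding matrix_vector_mult_def inner_vec_def
    by (intro closed_Collect_all closed_Collect_le continuous_intros)
  have "closed {V :: real^'n^'n. transpose V = V}"
    unfolding transpose_def vec_eq_iff by (simp, intro closed_Collect_all closed_Collect_eq continuous_intros)
  moreover have "{V :: real^'n^'n. pos_semidef V} = {V. transpose V = V} \<inter> {V. \<forall>x. 0 \<le> 1 * (x \<bullet> (V *v x))}"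
    by (auto simp: pos_semidef_def sym_mat_def)
  ultimately have "closed {V :: real^'n^'n. pos_semidef V}" using cl[of "\<lambda>_. 0" 1] by auto
  hence "{V :: real^'n^'n. pos_semidef V} \<in> sets borel" by simp
  moreover have "{V :: real^'n^'n. det V \<noteq> 0} \<in> sets borel" by measurable
  moreover have "{V :: real^'n^'n. pos_def V} = {V. pos_semidef V} \<inter> {V. det V \<noteq> 0}"
    using pos_def_imp_pos_semidef pos_semidef_invertible_imp_pos_def pos_def_invertible
    by (auto simp: invertible_det_nz)
  ultimately have D: "{V :: real^'n^'n. pos_def V} \<in> sets borel" by (metis sets.Int)
  show "?f \<in> borel_measurable borel"
    unfolding borel_measurable_iff_le
  proof
    fix r
    let ?E = "{V. pos_def V} \<inter> {V. \<forall>x. x \<bullet> (B *v x) \<le> r * (x \<bullet> (V *v x))}"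
    have "{V\<in>space borel. ?f V \<le> r} = ?E \<union> (if 0 \<le> r then - {V. pos_def V} else {})"
      using spec_radius_le_iff[OF _ B] by auto
    moreover have "?E \<in> sets borel"
      using D cl[of "\<lambda>x. x \<bullet> (B *v x)" r] by (intro sets.Int) auto
    moreover have "- {V :: real^'n^'n. pos_def V} \<in> sets borel" using D by (simp add: borel_comp)
    ultimately show "{V\<in>space borel. ?f V \<le> r} \<in> sets borel" by simp
  qed
qed

subsection \<open>Self-normalized bound\<close>

lemma measurable_info_alg:
  shows "k \<le> t \<Longrightarrow> Mr k \<in> borel_measurable (info_alg M Mr y t)"
    and "k < t \<Longrightarrow> y (Suc k) \<in> borel_measurable (info_alg M Mr y t)"
proof -
  let ?G = "(\<Union>k\<in>{..t}. {Mr k -` A \<inter> space M | A. A \<in> sets borel}) \<union>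
      (\<Union>k\<in>{..<t}. {y (Suc k) -` A \<inter> space M | A. A \<in> sets borel})"
  have G: "?G \<subseteq> Pow (space M)" by auto
  have sp: "space (info_alg M Mr y t) = space M" by (simp add: info_alg_def space_measure_of[OF G])
  have st: "?G \<subseteq> sets (info_alg M Mr y t)" unfolding info_alg_def sets_measure_of[OF G] by auto
  show "k \<le> t \<Longrightarrow> Mr k \<in> borel_measurable (info_alg M Mr y t)"
    using st by (intro measurableI) (auto simp: sp)
  show "k < t \<Longrightarrow> y (Suc k) \<in> borel_measurable (info_alg M Mr y t)"
    using st by (intro measurableI) (auto simp: sp)
qed

lemma subalgebra_info_alg:
  assumes "\<And>k. k \<le> t \<Longrightarrow> Mr k \<in> borel_measurable M"
    and "\<And>k. k < t \<Longrightarrow> y (Suc k) \<in> borel_measurable M"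
  shows "subalgebra M (info_alg M Mr y t)"
proof -
  let ?G = "(\<Union>k\<in>{..t}. {Mr k -` A \<inter> space M | A. A \<in> sets borel}) \<union>
      (\<Union>k\<in>{..<t}. {y (Suc k) -` A \<inter> space M | A. A \<in> sets borel})"
  have G: "?G \<subseteq> Pow (space M)" by auto
  have "?G \<subseteq> sets M" using assms by (auto intro: measurable_sets)
  thus ?thesis
    unfolding subalgebra_def info_alg_def space_measure_of[OF G] sets_measure_of[OF G]
    by (auto intro!: sets.sigma_sets_subset)
qed

text \<open>At the true parameter the residuals are the noise, and this is \<open>S\<^sub>t\<close>.
  It is expressed through \<open>y\<close> and \<open>Mr\<close> because they generate
  \<open>info_alg\<close>, which makes it adapted.\<close>

definition score :: "(nat \<Rightarrow> 'a \<Rightarrow> real^'n^'m) \<Rightarrow> (nat \<Rightarrow> 'a \<Rightarrow> real^'m) \<Rightarrow> real^'m^'m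
    \<Rightarrow> real^'n \<Rightarrow> nat \<Rightarrow> 'a \<Rightarrow> real^'n" where
  "score Mr y W \<theta> t \<omega> = (\<Sum>k<t. transpose (Mr k \<omega>) *v (W *v (y (Suc k) \<omega> - Mr k \<omega> *v \<theta>)))"

lemma borel_measurable_Vmat:
  assumes "\<And>k. k < t \<Longrightarrow> Mr k \<in> borel_measurable N"
  shows "Vmat Mr W t \<in> borel_measurable N"
proof -
  have "(\<lambda>\<omega>. transpose (Mr k \<omega>) ** W ** Mr k \<omega>) \<in> borel_measurable N" if "k < t" for k
    using assms[OF that, measurable] by measurable
  thus ?thesis unfolding Vmat_def[abs_def] by (intro borel_measurable_sum) auto
qed

lemma borel_measurable_score:
  assumes "\<And>k. k < t \<Longrightarrow> Mr k \<in> borel_measurable N" "\<And>k. k < t \<Longrightarrow> y (Suc k) \<in> borel_measurable N"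
  shows "score Mr y W \<theta> t \<in> borel_measurable N"
proof -
  have "(\<lambda>\<omega>. transpose (Mr k \<omega>) *v (W *v (y (Suc k) \<omega> - Mr k \<omega> *v \<theta>))) \<in> borel_measurable N" if "k < t" for k
    using assms(1)[OF that, measurable] assms(2)[OF that, measurable]
    by (simp del: transpose_matrix_vector)
  thus ?thesis unfolding score_def[abs_def] by (intro borel_measurable_sum) auto
qed

text \<open>If the noise were Gaussian with covariance \<open>c\<^sup>2\<close> times the inverse of
  \<open>W\<close>, this would be, at \<open>S\<^sub>t\<close> and \<open>V\<^sub>t\<close>, the
  log-likelihood ratio of the parameters \<open>\<theta>s + c *\<^sub>R l\<close> and
  \<open>\<theta>s\<close>.\<close>

definition log_lik :: "real \<Rightarrow> real^'n \<Rightarrow> real^'n^'n \<Rightarrow> real^'n \<Rightarrow> real" where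
  "log_lik c s V l = (l \<bullet> s) / c - (l \<bullet> (V *v l)) / 2"

lemma borel_measurable_log_lik [measurable (raw)]:
  assumes [measurable]: "s \<in> borel_measurable N" "V \<in> borel_measurable N" "l \<in> borel_measurable N"
  shows "(\<lambda>\<omega>. log_lik c (s \<omega>) (V \<omega>) (l \<omega>)) \<in> borel_measurable N"
  unfolding log_lik_def by measurable

text \<open>The method of mixtures: up to normalization, \<open>exp (log_lik \<dots>)\<close> is averaged over \<open>l\<close> drawn from the
  Gaussian distribution with mean \<open>0\<close> and covariance \<open>B\<inverse>\<close>.\<close>
definition mixture :: "real \<Rightarrow> real^'n^'n \<Rightarrow> real^'n \<Rightarrow> real^'n^'n \<Rightarrow> ennreal" where
  "mixture c B s V = (\<integral>\<^sup>+l. ennreal (exp (log_lik c s V l) * exp (- (l \<bullet> (B *v l)) / 2)) \<partial>lborel)"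

lemma borel_measurable_mixture [measurable (raw)]:
  assumes [measurable]: "s \<in> borel_measurable N" "V \<in> borel_measurable N"
  shows "(\<lambda>\<omega>. mixture c B (s \<omega>) (V \<omega>)) \<in> borel_measurable N"
  unfolding mixture_def by measurable

text \<open>The exponents combine to a Gaussian of precision \<open>V + B\<close> with peak at
  \<open>z / c\<close>. Describing \<open>z\<close> by a linear system keeps the inverse of
  \<open>V + B\<close> out of the formula.\<close>

lemma mixture_eq:
  fixes V B :: "real^'n^'n"
  assumes "pos_semidef V" "pos_def B" "c \<noteq> 0" and z: "(V + B) *v z = s"
  shows "mixture c B s V
    = ennreal (exp (z \<bullet> s / (2 * c\<^sup>2)) * sqrt ((2 * pi) ^ CARD('n) / det (V + B)))"
proof -
  let ?A = "V + B" and ?z = "(1 / c) *\<^sub>R z"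
  have "pos_def ?A" using assms by (intro pos_def_add_pos_semidef)
  note nn_integral_gaussian_linear[OF this, of ?z]
  moreover have "exp (log_lik c s V l) * exp (- (l \<bullet> (B *v l)) / 2)
      = exp (l \<bullet> (?A *v ?z) - (l \<bullet> (?A *v l)) / 2)" for l
  proof -
    have "l \<bullet> (?A *v ?z) = (l \<bullet> s) / c" by (simp add: matrix_vector_mult_scaleR z)
    thus ?thesis unfolding exp_add[symmetric]
      by (simp add: log_lik_def matrix_vector_mult_add_rdistrib inner_add_right add_divide_distrib)
  qed
  moreover have "?z \<bullet> (?A *v ?z) / 2 = z \<bullet> s / (2 * c\<^sup>2)"
    using assms(3) by (simp add: matrix_vector_mult_scaleR z power2_eq_square)
  ultimately show ?thesis unfolding mixture_def by simp
qed

lemma mixture_0: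
  fixes B :: "real^'n^'n"
  assumes "pos_def B"
  shows "mixture c B 0 0 = ennreal (sqrt ((2 * pi) ^ CARD('n) / det B))"
  using nn_integral_gaussian_pos_def[OF assms] by (simp add: mixture_def log_lik_def)

text \<open>The threshold is the initial value of the mixture divided by \<open>\<delta>\<close>.
  The powers of \<open>2 * pi\<close> cancel and the root of a ratio of determinants remains; its
  logarithm is halved by the root, hence the coefficient \<open>c\<^sup>2\<close> next to
  \<open>2 * c\<^sup>2\<close>.\<close>

lemma quadratic_bound_of_mixture_less:
  fixes V B :: "real^'n^'n"
  assumes V: "pos_semidef V" and B: "pos_def B" and c: "c > 0" and \<delta>: "\<delta> > 0" and z: "(V + B) *v z = s"
    and less: "mixture c B s V < ennreal (sqrt ((2 * pi) ^ CARD('n) / det B) / \<delta>)"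
  shows "z \<bullet> s \<le> c\<^sup>2 * ln (det (mat 1 + matrix_inv B ** V)) + 2 * c\<^sup>2 * ln (1 / \<delta>)"
proof -
  have A: "pos_def (V + B)" using V B by (rule pos_def_add_pos_semidef)
  define a b where "a = det (V + B)" and "b = det B"
  have pos: "a > 0" "b > 0" using A B by (auto simp: a_def b_def pos_def_det_pos)
  \<comment> \<open>Factoring out \<open>B\<close> gives the ratio of determinants the form it has
    in \<open>beta\<close>.\<close>
  have "B ** (mat 1 + matrix_inv B ** V) = V + B"
    using matrix_inv_mult[OF pos_def_invertible[OF B]]
    by (simp add: matrix_add_ldistrib matrix_mul_assoc add.commute)
  hence "b * det (mat 1 + matrix_inv B ** V) = a" unfolding a_def b_def by (metis det_mul)
  hence det: "det (mat 1 + matrix_inv B ** V) = a / b" using pos by (simp add: field_simps)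
  let ?C = "(2 * pi) ^ CARD('n)" and ?q = "z \<bullet> s / (2 * c\<^sup>2)"
  have "exp ?q * sqrt (?C / a) < sqrt (?C / b) / \<delta>"
    using less c \<delta> pos unfolding mixture_eq[OF V B less_imp_neq[OF c, symmetric] z] a_def[symmetric] b_def[symmetric]
    by (subst (asm) ennreal_less_iff) auto
  hence "exp ?q < sqrt (?C / b) / \<delta> / sqrt (?C / a)"
    by (subst pos_less_divide_eq) (use pos in auto)
  also have "\<dots> = sqrt (a / b) / \<delta>"
    using pos by (simp add: real_sqrt_divide)
  finally have "?q < ln (sqrt (a / b) / \<delta>)"
    using pos \<delta> by (metis exp_less_cancel_iff exp_ln divide_pos_pos real_sqrt_gt_zero)
  also have "\<dots> = ln (a / b) / 2 + ln (1 / \<delta>)"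
    using pos \<delta> by (simp add: ln_div ln_sqrt)
  finally have "?q * (2 * c\<^sup>2) \<le> (ln (a / b) / 2 + ln (1 / \<delta>)) * (2 * c\<^sup>2)"
    by (intro mult_right_mono) auto
  thus ?thesis using c by (simp add: det algebra_simps)
qed

section \<open>The regression model and its supermartingales\<close>

locale subgaussian_regression = prob_space M for M :: "'a measure" +
  fixes T :: enat and Mr :: "nat \<Rightarrow> 'a \<Rightarrow> real^'n^'m" and y w :: "nat \<Rightarrow> 'a \<Rightarrow> real^'m"
    and \<theta>s :: "real^'n" and W :: "real^'m^'m" and c :: real
  assumes Mr_meas: "\<And>t. enat t < T \<Longrightarrow> Mr t \<in> borel_measurable M"
    and y_meas: "\<And>t. enat (Suc t) \<le> T \<Longrightarrow> y (Suc t) \<in> borel_measurable M"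
    and w_meas: "\<And>t. enat t < T \<Longrightarrow> w t \<in> borel_measurable M"
    and model: "\<And>t \<omega>. enat t < T \<Longrightarrow> \<omega> \<in> space M \<Longrightarrow> y (Suc t) \<omega> = Mr t \<omega> *v \<theta>s + w t \<omega>"
    and W_pd: "pos_def W"
    and c_pos: "c > 0"
    and subgauss: "\<And>t \<nu>. enat t < T \<Longrightarrow>
        AE \<omega> in M. nn_cond_exp M (info_alg M Mr y t) (\<lambda>\<omega>. ennreal (exp (\<nu> \<bullet> w t \<omega>))) \<omega>
                     \<le> ennreal (exp (1/2 * c\<^sup>2 * (\<nu> \<bullet> (matrix_inv W *v \<nu>))))"
begin

abbreviation "V \<equiv> Vmat Mr W"
abbreviation "S \<equiv> score Mr y W \<theta>s"

lemma less_T: "enat t \<le> T \<Longrightarrow> k < t \<Longrightarrow> enat k < T"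
  by (metis enat_ord_simps(2) order_less_le_trans)

lemma Suc_le_T: "enat t \<le> T \<Longrightarrow> k < t \<Longrightarrow> enat (Suc k) \<le> T"
  by (meson Suc_leI enat_ord_simps(1) order_trans)

lemma V_measurable: "enat t \<le> T \<Longrightarrow> V t \<in> borel_measurable M"
  by (intro borel_measurable_Vmat Mr_meas less_T)

lemma S_measurable: "enat t \<le> T \<Longrightarrow> S t \<in> borel_measurable M"
  by (intro borel_measurable_score Mr_meas y_meas less_T Suc_le_T)

lemma V_pos_semidef: "pos_semidef (V t \<omega>)"
  using W_pd by (intro pos_semidef_Vmat pos_def_imp_pos_semidef)

text \<open>Pairing \<open>\<nu>\<close> with \<open>w t\<close> reproduces the increment of
  \<open>l \<bullet> S\<^sub>t / c\<close>, and the scaling by \<open>1 / c\<close> makes the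
  sub-Gaussian exponent equal to the increment of
  \<open>l \<bullet> V\<^sub>t l / 2\<close>.\<close>

lemma log_lik_Suc:
  fixes l :: "real^'n" and \<omega> :: 'a
  assumes t: "enat t < T" and \<omega>: "\<omega> \<in> space M"
  defines "\<nu> \<equiv> (1 / c) *\<^sub>R (W *v (Mr t \<omega> *v l))"
  shows "log_lik c (S (Suc t) \<omega>) (V (Suc t) \<omega>) l
    = log_lik c (S t \<omega>) (V t \<omega>) l + (\<nu> \<bullet> w t \<omega> - 1/2 * c\<^sup>2 * (\<nu> \<bullet> (matrix_inv W *v \<nu>)))"
proof -
  let ?x = "Mr t \<omega> *v l"
  have sym: "sym_mat W" using W_pd by (simp add: pos_def_def)
  have "S (Suc t) \<omega> = S t \<omega> + transpose (Mr t \<omega>) *v (W *v w t \<omega>)"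
    using model[OF t \<omega>] by (simp add: score_def del: transpose_matrix_vector)
  hence 1: "l \<bullet> S (Suc t) \<omega> = l \<bullet> S t \<omega> + (W *v ?x) \<bullet> w t \<omega>"
    by (simp add: inner_add_right inner_matrix_vector_mult[of l "transpose (Mr t \<omega>)"] matrix_selfadjoint[OF sym]
        del: transpose_matrix_vector)
  have "V (Suc t) \<omega> = V t \<omega> + transpose (Mr t \<omega>) ** W ** Mr t \<omega>" by (simp add: Vmat_def)
  hence 2: "l \<bullet> (V (Suc t) \<omega> *v l) = l \<bullet> (V t \<omega> *v l) + ?x \<bullet> (W *v ?x)"
    by (simp add: matrix_vector_mult_add_rdistrib inner_add_right inner_congruence)
  have "matrix_inv W *v (W *v ?x) = ?x"
    by (simp add: matrix_vector_mul_assoc[of "matrix_inv W" W] matrix_inv_mult pos_def_invertible[OF W_pd])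
  hence 3: "c\<^sup>2 * (\<nu> \<bullet> (matrix_inv W *v \<nu>)) = ?x \<bullet> (W *v ?x)"
    using c_pos by (simp add: \<nu>_def matrix_vector_mult_scaleR power2_eq_square inner_commute)
  show ?thesis
    unfolding log_lik_def 1 2 using 3 by (simp add: \<nu>_def add_divide_distrib)
qed

lemma likelihood_supermartingale:
  assumes t: "enat t < T" and C: "C \<in> sets (info_alg M Mr y t)"
  shows "(\<integral>\<^sup>+\<omega>. ennreal (exp (log_lik c (S (Suc t) \<omega>) (V (Suc t) \<omega>) l)) * indicator C \<omega> \<partial>M)
    \<le> (\<integral>\<^sup>+\<omega>. ennreal (exp (log_lik c (S t \<omega>) (V t \<omega>) l)) * indicator C \<omega> \<partial>M)"
proof -
  let ?F = "info_alg M Mr y t"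
  have tT: "enat t \<le> T" using t by simp
  have sub: "subalgebra M ?F"
    using t less_T[OF tT] by (intro subalgebra_info_alg Mr_meas y_meas Suc_le_T[OF tT]) (auto simp: le_less)
  have "finite_measure_subalgebra M ?F"
    using sub by unfold_locales
  then interpret sigma_finite_subalgebra M ?F
    by (rule finite_measure_subalgebra_is_sigma_finite)
  \<comment> \<open>The sums involve only indices below \<open>t\<close>, while \<open>Mr t\<close>
    already belongs to the information at time \<open>t\<close>; hence the direction
    \<open>\<nu>\<close> is known when \<open>w t\<close> is averaged.\<close>
  have [measurable]: "V t \<in> borel_measurable ?F" "S t \<in> borel_measurable ?F" "Mr t \<in> borel_measurable ?F"
    by (auto intro!: borel_measurable_Vmat borel_measurable_score measurable_info_alg)
  note C[measurable]
  define \<nu> where "\<nu> \<omega> = (1 / c) *\<^sub>R (W *v (Mr t \<omega> *v l))" for \<omega>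
  define \<psi> where "\<psi> v = 1/2 * c\<^sup>2 * (v \<bullet> (matrix_inv W *v v))" for v
  define Z where "Z \<omega> = ennreal (exp (log_lik c (S t \<omega>) (V t \<omega>) l)) * indicator C \<omega>" for \<omega>
  have "(\<integral>\<^sup>+\<omega>. ennreal (exp (log_lik c (S (Suc t) \<omega>) (V (Suc t) \<omega>) l)) * indicator C \<omega> \<partial>M)
      = (\<integral>\<^sup>+\<omega>. Z \<omega> * ennreal (exp (\<nu> \<omega> \<bullet> w t \<omega> - \<psi> (\<nu> \<omega>))) \<partial>M)"
  proof (rule nn_integral_cong)
    fix \<omega> assume "\<omega> \<in> space M"
    show "ennreal (exp (log_lik c (S (Suc t) \<omega>) (V (Suc t) \<omega>) l)) * indicator C \<omega>
      = Z \<omega> * ennreal (exp (\<nu> \<omega> \<bullet> w t \<omega> - \<psi> (\<nu> \<omega>)))"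
      unfolding log_lik_Suc[OF t \<open>\<omega> \<in> space M\<close>] Z_def \<nu>_def \<psi>_def
      by (simp only: exp_add ennreal_mult' exp_ge_zero mult_ac)
  qed
  also have "\<dots> \<le> (\<integral>\<^sup>+\<omega>. Z \<omega> \<partial>M)"
  proof (rule nn_integral_exp_inner_le[OF w_meas[OF t]])
    show "continuous_on UNIV \<psi>" unfolding \<psi>_def by (intro continuous_intros)
    show "Z \<in> borel_measurable ?F" "\<nu> \<in> borel_measurable ?F" unfolding Z_def \<nu>_def by measurable
  qed (use subgauss[OF t] in \<open>simp add: \<psi>_def\<close>)
  finally show ?thesis by (simp add: Z_def)
qed

text \<open>Tonelli's theorem exchanges the Gaussian average with the expectation, and for each
  fixed \<open>l\<close> the inequality is known.\<close>

lemma mixture_supermartingale: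
  assumes t: "enat t < T" and C: "C \<in> sets (info_alg M Mr y t)"
  shows "(\<integral>\<^sup>+\<omega>. mixture c B (S (Suc t) \<omega>) (V (Suc t) \<omega>) * indicator C \<omega> \<partial>M)
    \<le> (\<integral>\<^sup>+\<omega>. mixture c B (S t \<omega>) (V t \<omega>) * indicator C \<omega> \<partial>M)"
proof -
  interpret pair_sigma_finite M "lborel :: (real^'n) measure" ..
  have tT: "enat t \<le> T" "enat (Suc t) \<le> T" using t by (auto simp: Suc_ile_eq)
  have "subalgebra M (info_alg M Mr y t)"
    using t less_T[OF tT(1)] by (intro subalgebra_info_alg Mr_meas y_meas Suc_le_T[OF tT(1)]) (auto simp: le_less)
  hence [measurable]: "C \<in> sets M" using C by (auto simp: subalgebra_def)
  let ?g = "\<lambda>l. ennreal (exp (- (l \<bullet> (B *v l)) / 2))"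
  have eq: "(\<integral>\<^sup>+\<omega>. mixture c B (S k \<omega>) (V k \<omega>) * indicator C \<omega> \<partial>M)
      = (\<integral>\<^sup>+l. ?g l * (\<integral>\<^sup>+\<omega>. ennreal (exp (log_lik c (S k \<omega>) (V k \<omega>) l)) * indicator C \<omega> \<partial>M) \<partial>lborel)"
    if k: "enat k \<le> T" for k
  proof -
    note V_measurable[OF k, measurable] S_measurable[OF k, measurable]
    have "(\<integral>\<^sup>+\<omega>. mixture c B (S k \<omega>) (V k \<omega>) * indicator C \<omega> \<partial>M)
      = (\<integral>\<^sup>+\<omega>. (\<integral>\<^sup>+l. ?g l * (ennreal (exp (log_lik c (S k \<omega>) (V k \<omega>) l)) * indicator C \<omega>) \<partial>lborel) \<partial>M)"
      unfolding mixture_def by (subst nn_integral_multc[symmetric]) (auto simp: ennreal_mult' mult_ac)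
    also have "\<dots> = (\<integral>\<^sup>+l. (\<integral>\<^sup>+\<omega>. ?g l * (ennreal (exp (log_lik c (S k \<omega>) (V k \<omega>) l)) * indicator C \<omega>) \<partial>M) \<partial>lborel)"
      by (intro Fubini'[symmetric]) measurable
    also have "\<dots> = (\<integral>\<^sup>+l. ?g l * (\<integral>\<^sup>+\<omega>. ennreal (exp (log_lik c (S k \<omega>) (V k \<omega>) l)) * indicator C \<omega> \<partial>M) \<partial>lborel)"
      by (intro nn_integral_cong nn_integral_cmult) measurable
    finally show ?thesis .
  qed
  show ?thesis
    unfolding eq[OF tT(1)] eq[OF tT(2)]
    by (intro nn_integral_mono mult_left_mono likelihood_supermartingale t C) simp
qed

text \<open>Ville's inequality at the level \<open>K / \<delta>\<close>, where \<open>K\<close> is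
  the deterministic initial value of the mixture, bounds the probability of a crossing by
  \<open>\<delta>\<close>. As \<open>E\<close> is chosen before \<open>t\<close> and
  \<open>z\<close>, the bound is uniform in time.\<close>

lemma self_normalized_bound:
  fixes B :: "real^'n^'n"
  assumes B: "pos_def B" and \<delta>: "0 < \<delta>"
  obtains E where "E \<in> sets M" "prob E \<ge> 1 - \<delta>"
    "\<And>\<omega> t z. \<omega> \<in> E \<Longrightarrow> enat t \<le> T \<Longrightarrow> (V t \<omega> + B) *v z = S t \<omega> \<Longrightarrow>
       z \<bullet> S t \<omega> \<le> c\<^sup>2 * ln (det (mat 1 + matrix_inv B ** V t \<omega>)) + 2 * c\<^sup>2 * ln (1 / \<delta>)"
proof -
  \<comment> \<open>Beyond a finite horizon the process is continued by 0: the mean still does not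
    increase and the positive level is not reached there, so all natural times can be treated
    alike.\<close>
  define X where "X t \<omega> = (if enat t \<le> T then mixture c B (S t \<omega>) (V t \<omega>) else 0)" for t \<omega>
  define K where "K = sqrt ((2 * pi) ^ CARD('n) / det B)"
  have K: "K > 0" using pos_def_det_pos[OF B] by (simp add: K_def)
  let ?a = "ennreal (K / \<delta>)"
  have X[measurable]: "X t \<in> borel_measurable M" for t
  proof (cases "enat t \<le> T")
    case True
    note V_measurable[OF True, measurable] S_measurable[OF True, measurable]
    show ?thesis using True by (simp add: X_def[abs_def])
  qed (simp add: X_def[abs_def])
  let ?bad = "{\<omega>\<in>space M. \<exists>t. ?a \<le> X t \<omega>}"
  have "?a * emeasure M ?bad \<le> ennreal K"
  proof (rule ville_inequality[OF X])
    have "X 0 \<omega> = ennreal K" for \<omega>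
      using mixture_0[OF B, of c] by (simp add: X_def K_def score_def Vmat_def zero_enat_def[symmetric])
    thus "(\<integral>\<^sup>+\<omega>. X 0 \<omega> \<partial>M) \<le> ennreal K" by (simp add: emeasure_space_1)
    fix t
    let ?C = "{\<omega>\<in>space M. \<forall>s\<le>t. X s \<omega> < ?a}"
    show "(\<integral>\<^sup>+\<omega>. X (Suc t) \<omega> * indicator ?C \<omega> \<partial>M) \<le> (\<integral>\<^sup>+\<omega>. X t \<omega> * indicator ?C \<omega> \<partial>M)"
    proof (cases "enat (Suc t) \<le> T")
      case True
      hence t: "enat t < T" by (simp add: Suc_ile_eq)
      let ?F = "info_alg M Mr y t"
      have "X s \<in> borel_measurable ?F" if "s \<le> t" for s
      proof -
        have [measurable]: "V s \<in> borel_measurable ?F" "S s \<in> borel_measurable ?F"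
          using that by (auto intro!: borel_measurable_Vmat borel_measurable_score measurable_info_alg)
        show ?thesis unfolding X_def[abs_def] by measurable
      qed
      \<comment> \<open>Whether the level has been crossed by time \<open>t\<close> is decided by
        the information at time \<open>t\<close>, so the event qualifies for the supermartingale
        inequality.\<close>
      hence "{\<omega>\<in>space ?F. \<forall>s\<in>{..t}. X s \<omega> < ?a} \<in> sets ?F"
        by (intro sets.sets_Collect_finite_All') (auto intro!: borel_measurable_less)
      moreover have "space ?F = space M" unfolding info_alg_def by (rule space_measure_of) auto
      moreover have "?C = {\<omega>\<in>space M. \<forall>s\<in>{..t}. X s \<omega> < ?a}" by blast
      ultimately have C: "?C \<in> sets ?F" by (simp only:)
      have "X (Suc t) = (\<lambda>\<omega>. mixture c B (S (Suc t) \<omega>) (V (Suc t) \<omega>))"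
        "X t = (\<lambda>\<omega>. mixture c B (S t \<omega>) (V t \<omega>))"
        using True t by (auto simp: X_def fun_eq_iff)
      with mixture_supermartingale[OF t C, of B] show ?thesis by simp
    qed (simp add: X_def)
  qed
  hence "ennreal (K / \<delta>) * ennreal (prob ?bad) \<le> ennreal K"
    by (simp only: emeasure_eq_measure)
  hence "ennreal (K / \<delta> * prob ?bad) \<le> ennreal K"
    using K \<delta> by (subst ennreal_mult) (auto simp only: measure_nonneg divide_nonneg_pos less_imp_le)
  hence "K / \<delta> * prob ?bad \<le> K" using K by (subst (asm) ennreal_le_iff) auto
  hence bad: "prob ?bad \<le> \<delta>" using K \<delta> by (simp add: field_simps)
  show ?thesis
  proof (rule that[of "space M - ?bad"])
    show "prob (space M - ?bad) \<ge> 1 - \<delta>" using bad by (subst prob_compl) auto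
    fix \<omega> t z assume "\<omega> \<in> space M - ?bad" and t: "enat t \<le> T" and z: "(V t \<omega> + B) *v z = S t \<omega>"
    hence "X t \<omega> < ?a" by (auto simp: not_le)
    hence "mixture c B (S t \<omega>) (V t \<omega>) < ?a" using t by (simp add: X_def)
    thus "z \<bullet> S t \<omega> \<le> c\<^sup>2 * ln (det (mat 1 + matrix_inv B ** V t \<omega>)) + 2 * c\<^sup>2 * ln (1 / \<delta>)"
      unfolding K_def by (rule quadratic_bound_of_mixture_less[OF V_pos_semidef B c_pos \<delta> z])
  qed simp
qed

text \<open>Where \<open>V t \<omega>\<close> is invertible, the estimator and the spectral radius
  are replaced by the measurable functions \<open>est\<close> and \<open>rad\<close>; elsewhere the
  implication is vacuous.\<close>

lemma confidence_set_measurable: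
  fixes P B :: "real^'n^'n"
  assumes P: "pos_semidef P" and B: "pos_def B" and t: "enat t \<le> T"
  shows "{\<omega>\<in>space M. invertible (V t \<omega>) \<longrightarrow>
      wnorm (P + V t \<omega>) (\<theta>s - theta_hat Mr y W P \<mu> t \<omega>) \<le> beta c\<theta> c \<delta> B (V t \<omega>)} \<in> sets M"
proof -
  note V_measurable[OF t, measurable]
  let ?H = "\<lambda>\<omega>. P + V t \<omega>" and ?b = "ls_rhs Mr y W P \<mu> t"
  have [measurable]: "?b \<in> borel_measurable M"
  proof -
    have "(\<lambda>\<omega>. transpose (Mr k \<omega>) *v (W *v y (Suc k) \<omega>)) \<in> borel_measurable M" if "k < t" for k
      using Mr_meas[OF less_T[OF t that], measurable] y_meas[OF Suc_le_T[OF t that], measurable]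
      by (simp del: transpose_matrix_vector)
    thus ?thesis
      unfolding ls_rhs_def[abs_def] by (intro borel_measurable_add borel_measurable_sum) auto
  qed
  \<comment> \<open>Cramer's rule for the normal equations: a quotient of determinants, measurable
    also where the denominator is 0.\<close>
  define est where
    "est \<omega> = (\<chi> k. det (\<chi> i j. if j = k then ?b \<omega> $ i else ?H \<omega> $ i $ j) / det (?H \<omega>))" for \<omega>
  define rad where "rad A = (if pos_def A then spec_radius (matrix_inv A ** B) else 0)" for A
  have est_meas[measurable]: "est \<in> borel_measurable M"
  proof (intro borel_measurable_vecI)
    fix k
    have [measurable]: "(\<lambda>\<omega>. \<chi> i j. if j = k then ?b \<omega> $ i else ?H \<omega> $ i $ j) \<in> borel_measurable M"
      by (intro borel_measurable_vecI) simp
    show "(\<lambda>\<omega>. est \<omega> $ k) \<in> borel_measurable M" unfolding est_def by simp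
  qed
  have [measurable]: "rad \<in> borel_measurable borel"
    unfolding rad_def by (rule borel_measurable_spec_radius[OF B])
  have pd: "pos_def (V t \<omega>)" if "invertible (V t \<omega>)" for \<omega>
    using that V_pos_semidef by (rule pos_semidef_invertible_imp_pos_def[rotated])
  have est: "theta_hat Mr y W P \<mu> t \<omega> = est \<omega>" if "invertible (V t \<omega>)" for \<omega>
  proof -
    have H: "pos_def (?H \<omega>)" using P pd[OF that] by (rule pos_def_add_pos_semidef)
    hence "det (?H \<omega>) \<noteq> 0" using pos_def_det_pos by force
    thus ?thesis
      using theta_hat_normal_equation[OF pos_def_imp_pos_semidef[OF W_pd] P H] cramer
      unfolding est_def by blast
  qed
  have "{\<omega>\<in>space M. invertible (V t \<omega>) \<longrightarrow>
      wnorm (?H \<omega>) (\<theta>s - theta_hat Mr y W P \<mu> t \<omega>) \<le> beta c\<theta> c \<delta> B (V t \<omega>)}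
    = {\<omega>\<in>space M. det (V t \<omega>) \<noteq> 0 \<longrightarrow>
        sqrt ((\<theta>s - est \<omega>) \<bullet> (?H \<omega> *v (\<theta>s - est \<omega>)))
        \<le> sqrt (1 + rad (V t \<omega>)) *
          sqrt (c\<theta>\<^sup>2 + c\<^sup>2 * ln (det (mat 1 + matrix_inv B ** V t \<omega>)) + 2 * c\<^sup>2 * ln (1 / \<delta>))}"
    using est pd by (auto simp: invertible_det_nz wnorm_def beta_def rad_def)
  also have "\<dots> \<in> sets M"
  proof -
    have 1: "(\<lambda>\<omega>. (\<theta>s - est \<omega>) \<bullet> (?H \<omega> *v (\<theta>s - est \<omega>))) \<in> borel_measurable M" by measurable
    have 2: "(\<lambda>\<omega>. rad (V t \<omega>)) \<in> borel_measurable M" by measurable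
    have 3: "(\<lambda>\<omega>. det (mat 1 + matrix_inv B ** V t \<omega>)) \<in> borel_measurable M" by measurable
    have 4: "(\<lambda>\<omega>. det (V t \<omega>)) \<in> borel_measurable M" by measurable
    \<comment> \<open>With arbitrary measurable functions as parameters, only the outer shape of the
      event has to be analysed.\<close>
    have "{\<omega>\<in>space M. d \<omega> \<noteq> 0 \<longrightarrow> sqrt (f \<omega>) \<le> sqrt (1 + r \<omega>) * sqrt (a + a' * ln (g \<omega>) + a'')} \<in> sets M"
      if [measurable]: "d \<in> borel_measurable M" "f \<in> borel_measurable M" "r \<in> borel_measurable M"
        "g \<in> borel_measurable M" for d f r g :: "'a \<Rightarrow> real" and a a' a''
      by measurable
    from this[OF 4 1 2 3] show ?thesis .
  qed
  finally show ?thesis .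
qed

end

theorem theorem3:
  fixes M :: "'a measure"
    and T :: enat
    and Mr :: "nat \<Rightarrow> 'a \<Rightarrow> real^'n^'m"
    and y :: "nat \<Rightarrow> 'a \<Rightarrow> real^'m"
    and w :: "nat \<Rightarrow> 'a \<Rightarrow> real^'m"
    and \<theta>s \<mu> :: "real^'n"
    and W :: "real^'m^'m"
    and P Vbar :: "real^'n^'n"
    and cw c\<theta> \<delta> :: real
  assumes "prob_space M"
    and Mr_meas: "\<And>t. enat t < T \<Longrightarrow> Mr t \<in> borel_measurable M"
    and y_meas: "\<And>t. enat (Suc t) \<le> T \<Longrightarrow> y (Suc t) \<in> borel_measurable M"
    and w_meas: "\<And>t. enat t < T \<Longrightarrow> w t \<in> borel_measurable M"
    and model: "\<And>t \<omega>. enat t < T \<Longrightarrow> \<omega> \<in> space M \<Longrightarrow> y (Suc t) \<omega> = Mr t \<omega> *v \<theta>s + w t \<omega>"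
    and W_pd: "pos_def W"
    and P_psd: "pos_semidef P"
    and cw_pos: "cw > 0"
    and subgauss: "\<And>t \<nu>. enat t < T \<Longrightarrow>
        AE \<omega> in M. nn_cond_exp M (info_alg M Mr y t) (\<lambda>\<omega>. ennreal (exp (\<nu> \<bullet> w t \<omega>))) \<omega>
                     \<le> ennreal (exp (1/2 * cw\<^sup>2 * (\<nu> \<bullet> (matrix_inv W *v \<nu>))))"
    and c\<theta>_nonneg: "c\<theta> \<ge> 0"
    and prior: "wnorm P (\<theta>s - \<mu>) \<le> c\<theta>"
    and Vbar_pd: "pos_def Vbar"
    and \<delta>_range: "0 < \<delta>" "\<delta> < 1"
  shows "prob_space.prob M {\<omega> \<in> space M. \<forall>t. enat t \<le> T \<longrightarrow> invertible (Vmat Mr W t \<omega>) \<longrightarrow>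
            wnorm (P + Vmat Mr W t \<omega>) (\<theta>s - theta_hat Mr y W P \<mu> t \<omega>)
              \<le> beta c\<theta> cw \<delta> Vbar (Vmat Mr W t \<omega>)} \<ge> 1 - \<delta>"
    (is "_ \<le> prob_space.prob M ?good")
proof -
  interpret prob_space M by fact
  interpret subgaussian_regression M T Mr y w \<theta>s W cw
    using assms by unfold_locales auto
  obtain E where E: "E \<in> sets M" "prob E \<ge> 1 - \<delta>"
    "\<And>\<omega> t z. \<omega> \<in> E \<Longrightarrow> enat t \<le> T \<Longrightarrow> (V t \<omega> + Vbar) *v z = S t \<omega> \<Longrightarrow>
       z \<bullet> S t \<omega> \<le> cw\<^sup>2 * ln (det (mat 1 + matrix_inv Vbar ** V t \<omega>)) + 2 * cw\<^sup>2 * ln (1 / \<delta>)"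
    using self_normalized_bound[OF Vbar_pd \<delta>_range(1)] by blast
  \<comment> \<open>Monotonicity of \<open>prob\<close> is applied with \<open>?good\<close> as the
    larger set, and a nonmeasurable set would have measure 0. A countable intersection over the
    times settles this.\<close>
  have good: "?good \<in> sets M"
  proof -
    let ?A = "\<lambda>t. {\<omega>\<in>space M. enat t \<le> T \<longrightarrow> invertible (V t \<omega>) \<longrightarrow>
            wnorm (P + V t \<omega>) (\<theta>s - theta_hat Mr y W P \<mu> t \<omega>) \<le> beta c\<theta> cw \<delta> Vbar (V t \<omega>)}"
    have "?A t \<in> sets M" for t
    proof (cases "enat t \<le> T")
      case True
      show ?thesis
        using confidence_set_measurable[OF P_psd Vbar_pd True, of \<mu> c\<theta> \<delta>]
        by (simp only: True simp_thms)
    qed simp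
    hence "(\<Inter>t. ?A t) \<in> sets M" by (intro sets.countable_INT image_subsetI UNIV_not_empty)
    moreover have "?good = (\<Inter>t. ?A t)" by auto
    ultimately show ?thesis by (simp only:)
  qed
  \<comment> \<open>From here on the argument is deterministic, for a single outcome in
    \<open>E\<close>.\<close>
  have "E \<subseteq> ?good"
  proof (intro subsetI CollectI conjI allI impI)
    fix \<omega> assume \<omega>: "\<omega> \<in> E"
    thus sp: "\<omega> \<in> space M" using E(1) sets.sets_into_space by blast
    fix t assume t: "enat t \<le> T" and inv: "invertible (V t \<omega>)"
    let ?V = "V t \<omega>" and ?e = "\<theta>s - \<mu>" and ?x = "\<theta>s - theta_hat Mr y W P \<mu> t \<omega>"
    let ?\<rho> = "spec_radius (matrix_inv ?V ** Vbar)"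
    let ?L = "cw\<^sup>2 * ln (det (mat 1 + matrix_inv Vbar ** ?V)) + 2 * cw\<^sup>2 * ln (1 / \<delta>)"
    have V_pd: "pos_def ?V" using V_pos_semidef inv by (rule pos_semidef_invertible_imp_pos_def)
    have H_pd: "pos_def (P + ?V)" using P_psd V_pd by (rule pos_def_add_pos_semidef)
    have A_pd: "pos_def (?V + Vbar)" using V_pos_semidef Vbar_pd by (rule pos_def_add_pos_semidef)
    define z where "z = matrix_inv (?V + Vbar) *v S t \<omega>"
    have z: "(?V + Vbar) *v z = S t \<omega>"
      by (simp add: z_def matrix_vector_mul_assoc matrix_inv_mult pos_def_invertible[OF A_pd])
    \<comment> \<open>Subtracting the normal equations from \<open>(P + ?V) *v \<theta>s\<close>
      turns \<open>\<mu>\<close> into the prior error and the outputs into residuals.\<close>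
    have "(P + ?V) *v ?x = P *v ?e - S t \<omega>"
      using theta_hat_normal_equation[OF pos_def_imp_pos_semidef[OF W_pd] P_psd H_pd]
      by (simp add: matrix_vector_mult_diff_distrib ls_rhs_def matrix_vector_mult_add_rdistrib Vmat_mult_vec
          score_def sum_subtractf del: transpose_matrix_vector)
    note bound = weighted_error_bound[OF P_psd V_pd Vbar_pd this[folded z]]
    have "?e \<bullet> (P *v ?e) \<le> c\<theta>\<^sup>2"
      using prior by (simp add: wnorm_def sqrt_le_D)
    \<comment> \<open>The prior term is enlarged by the factor of the noise term, so that both fit
      under the common factor in \<open>beta\<close>.\<close>
    also have "\<dots> \<le> (1 + ?\<rho>) * c\<theta>\<^sup>2" using bound(1) by (simp add: algebra_simps)
    finally have prior': "?e \<bullet> (P *v ?e) \<le> (1 + ?\<rho>) * c\<theta>\<^sup>2" .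
    have "(1 + ?\<rho>) * (z \<bullet> S t \<omega>) \<le> (1 + ?\<rho>) * ?L"
      using bound(1) by (intro mult_left_mono E(3)[OF \<omega> t z]) simp
    with bound(2) prior' have "?x \<bullet> ((P + ?V) *v ?x) \<le> (1 + ?\<rho>) * c\<theta>\<^sup>2 + (1 + ?\<rho>) * ?L"
      unfolding z by linarith
    also have "\<dots> = (1 + ?\<rho>) * (c\<theta>\<^sup>2 + ?L)" by (simp add: distrib_left)
    finally show "wnorm (P + ?V) ?x \<le> beta c\<theta> cw \<delta> Vbar ?V"
      unfolding wnorm_def beta_def real_sqrt_mult[symmetric] by (simp add: add.assoc)
  qed
  hence "prob E \<le> prob ?good" using good by (rule finite_measure_mono)
  with E(2) show ?thesis by simp
qed

end
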